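(* Let $G$ be a locally quasi-convex hyperbolic group and let $\mathcal{A}$ be a finite almost malnormal collection of finitely generated subgroups of $G$. Then $G$ has the f.c.i.p. relative to $\mathcal{A}$ and, for every $A\in\mathcal{A}$, the pair $(G,A)$ has the $A$-f.g.i.p.
   Context: Conventions: $H^g=g^{-1}Hg$. A hyperbolic (i.e. word-hyperbolic, finitely generated) group is locally quasi-convex if each of its finitely generated subgroups is quasi-convex. A finite collection $\mathcal A=(A_\alpha)_\alpha$ of subgroups of $G$ is an almost malnormal collection if for all $\alpha,\beta$ and all $g\in G$, either $A_\alpha\cap A_\beta^g$ is finite, or $\alpha=\beta$ and $g\in A_\beta$. f.g.i.p.: a group $G$ has the f.g.i.p. if the intersection of any two finitely generated subgroups is finitely generated. For a subgroup $A\le G$, the pair $(G,A)$ has the $A$-f.g.i.p. if $G$ has the f.g.i.p. and for all finitely generated $H,K\le G$ there are only finitely many double cosets $HgK$ with $g\in A$ and $H^g\cap K\not\le A$. f.c.i.p.: for finitely generated subgroups $A,B,C\le G$ and $f,g\in G$, let $$q^A_{f,g}\colon (A\cap B^f)\backslash A/(A\cap C^g)\to B\backslash G/C,\qquad (A\cap B^f)\,a\,(A\cap C^g)\mapsto B\,fag^{-1}\,C$$ (a well-defined map). Let $\mathcal A$ be a collection (indexed family) of finitely generated subgroups of $G$. $G$ has the f.c.i.p. relative to $\mathcal A$ if for every pair $B,C$ of finitely generated subgroups of $G$ and every choice, for each $A\in\mathcal A$, of finite sets $\mathcal F_A,\mathcal G_A\subset G$ whose elements lie in pairwise distinct $(B,A)$-double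 cosets, respectively $(C,A)$-double cosets, one has $$\sum_{BhC\in B\backslash G/C}\max\Big\{0,\Big(\sum_{A\in\mathcal A}\ \sum_{f\in\mathcal F_A,\,g\in\mathcal G_A}\big|(q^A_{f,g})^{-1}(BhC)\big|\Big)-1\Big\}<\infty .$$ *)

theory Defs
  imports "HOL-Algebra.Generated_Groups" "HOL-Analysis.Infinite_Sum" "HOL-Analysis.Measure_Space"
begin

section \<open>Finitely generated subgroups, conjugates and double cosets\<close>

definition fg_subgroup :: "('a, 'b) monoid_scheme \<Rightarrow> 'a set \<Rightarrow> bool" where
  "fg_subgroup G H \<longleftrightarrow>
     subgroup H G \<and> (\<exists>S. finite S \<and> S \<subseteq> carrier G \<and> generate G S = H)"

definition conjugate :: "('a, 'b) monoid_scheme \<Rightarrow> 'a set \<Rightarrow> 'a \<Rightarrow> 'a set" where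
  "conjugate G H g = (inv\<^bsub>G\<^esub> g <#\<^bsub>G\<^esub> H) #>\<^bsub>G\<^esub> g"

definition dcoset :: "('a, 'b) monoid_scheme \<Rightarrow> 'a set \<Rightarrow> 'a \<Rightarrow> 'a set \<Rightarrow> 'a set" where
  "dcoset G H g K = (H #>\<^bsub>G\<^esub> g) <#>\<^bsub>G\<^esub> K"

definition dcosets :: "('a, 'b) monoid_scheme \<Rightarrow> 'a set \<Rightarrow> 'a set \<Rightarrow> 'a set set" where
  "dcosets G H K = (\<lambda>g. dcoset G H g K) ` carrier G"


section \<open>Locally quasi-convex hyperbolic groups\<close>

text \<open>
  The Cayley graph is the undirected one, with edges between \<open>x\<close> and \<open>x s\<close>, so
  that the word metric is invariant under left multiplication and \<open>S\<close> need not be symmetric.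
\<close>

definition cayley_graph :: "('a, 'b) monoid_scheme \<Rightarrow> 'a set \<Rightarrow> ('a \<times> 'a) set" where
  "cayley_graph G S =
     {(x, y). x \<in> carrier G \<and> y \<in> carrier G \<and> (\<exists>s\<in>S. y = x \<otimes>\<^bsub>G\<^esub> s \<or> x = y \<otimes>\<^bsub>G\<^esub> s)}"

text \<open>Meaningful only if \<open>S\<close> generates \<open>G\<close>, that is, if the Cayley graph is connected.\<close>

definition word_dist :: "('a, 'b) monoid_scheme \<Rightarrow> 'a set \<Rightarrow> 'a \<Rightarrow> 'a \<Rightarrow> nat" where
  "word_dist G S x y = (LEAST n. (x, y) \<in> cayley_graph G S ^^ n)"

text \<open>A geodesic from \<open>x\<close> to \<open>y\<close>, given by the list of the vertices it passes through.\<close>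

definition geodesic :: "('a, 'b) monoid_scheme \<Rightarrow> 'a set \<Rightarrow> 'a \<Rightarrow> 'a list \<Rightarrow> 'a \<Rightarrow> bool" where
  "geodesic G S x p y \<longleftrightarrow>
     p \<noteq> [] \<and> hd p = x \<and> last p = y \<and> set p \<subseteq> carrier G \<and>
     successively (\<lambda>u v. (u, v) \<in> cayley_graph G S) p \<and>
     length p = Suc (word_dist G S x y)"

text \<open>
  Slim triangles. Only the side \<open>p\<close> is mentioned, since the condition
  ranges over all triangles and hence also over their cyclic rotations.
\<close>

definition hyperbolic_wrt :: "('a, 'b) monoid_scheme \<Rightarrow> 'a set \<Rightarrow> bool" where
  "hyperbolic_wrt G S \<longleftrightarrow>
     (\<exists>\<delta>. \<forall>x y z p q r.
        geodesic G S x p y \<and> geodesic G S y q z \<and> geodesic G S z r x \<longrightarrow>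
        (\<forall>u\<in>set p. \<exists>v\<in>set q \<union> set r. word_dist G S u v \<le> \<delta>))"

definition quasiconvex_wrt :: "('a, 'b) monoid_scheme \<Rightarrow> 'a set \<Rightarrow> 'a set \<Rightarrow> bool" where
  "quasiconvex_wrt G S H \<longleftrightarrow>
     (\<exists>\<kappa>. \<forall>h\<in>H. \<forall>k\<in>H. \<forall>p.
        geodesic G S h p k \<longrightarrow> (\<forall>u\<in>set p. \<exists>v\<in>H. word_dist G S u v \<le> \<kappa>))"

text \<open>
  For a group, hyperbolicity does not depend on the finite generating set, and
  for a hyperbolic group neither does quasi-convexity of a subgroup. Both are therefore
  expressed with respect to one common finite generating set.
\<close>

definition locally_quasiconvex_hyperbolic :: "('a, 'b) monoid_scheme \<Rightarrow> bool" where
  "locally_quasiconvex_hyperbolic G \<longleftrightarrow>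
     group G \<and>
     (\<exists>S. finite S \<and> S \<subseteq> carrier G \<and> generate G S = carrier G \<and>
          hyperbolic_wrt G S \<and>
          (\<forall>H. fg_subgroup G H \<longrightarrow> quasiconvex_wrt G S H))"


section \<open>Almost malnormal collections\<close>

definition almost_malnormal_collection ::
    "('a, 'b) monoid_scheme \<Rightarrow> 'i set \<Rightarrow> ('i \<Rightarrow> 'a set) \<Rightarrow> bool" where
  "almost_malnormal_collection G I A \<longleftrightarrow>
     (\<forall>\<alpha>\<in>I. \<forall>\<beta>\<in>I. \<forall>g\<in>carrier G.
        finite (A \<alpha> \<inter> conjugate G (A \<beta>) g) \<or> (\<alpha> = \<beta> \<and> g \<in> A \<beta>))"


section \<open>Finitely generated intersection properties\<close>

definition fgip :: "('a, 'b) monoid_scheme \<Rightarrow> bool" where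
  "fgip G \<longleftrightarrow> (\<forall>H K. fg_subgroup G H \<and> fg_subgroup G K \<longrightarrow> fg_subgroup G (H \<inter> K))"

definition relative_fgip :: "('a, 'b) monoid_scheme \<Rightarrow> 'a set \<Rightarrow> bool" where
  "relative_fgip G A \<longleftrightarrow>
     fgip G \<and>
     (\<forall>H K. fg_subgroup G H \<and> fg_subgroup G K \<longrightarrow>
        finite {dcoset G H g K | g. g \<in> A \<and> \<not> conjugate G H g \<inter> K \<subseteq> A})"


section \<open>The finite coset intersection property\<close>

text \<open>
  The map sending \<open>(A \<inter> B\<^sup>f) a (A \<inter> C\<^sup>g)\<close> to \<open>B f a g\<inverse> C\<close>. The image of a
  double coset under \<open>\<lambda>a. B f a g\<inverse> C\<close> is a singleton; see \<open>coset_map_dcoset\<close> below.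
\<close>

definition coset_map ::
    "('a, 'b) monoid_scheme \<Rightarrow> 'a set \<Rightarrow> 'a set \<Rightarrow> 'a \<Rightarrow> 'a \<Rightarrow> 'a set \<Rightarrow> 'a set" where
  "coset_map G B C f g X =
     the_elem ((\<lambda>a. dcoset G B (f \<otimes>\<^bsub>G\<^esub> a \<otimes>\<^bsub>G\<^esub> inv\<^bsub>G\<^esub> g) C) ` X)"

definition coset_map_fibre ::
    "('a, 'b) monoid_scheme \<Rightarrow> 'a set \<Rightarrow> 'a set \<Rightarrow> 'a set \<Rightarrow> 'a \<Rightarrow> 'a \<Rightarrow> 'a set \<Rightarrow> 'a set set" where
  "coset_map_fibre G A B C f g D =
     {X \<in> dcosets (G\<lparr>carrier := A\<rparr>) (A \<inter> conjugate G B f) (A \<inter> conjugate G C g).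
        coset_map G B C f g X = D}"

text \<open>
  The cardinality of a set as an extended nonnegative number, infinite sets having
  cardinality \<open>\<infinity>\<close> (whereas \<^const>\<open>card\<close> would give 0).
\<close>

abbreviation ecard :: "'a set \<Rightarrow> ennreal" where
  "ecard X \<equiv> emeasure (count_space UNIV) X"

text \<open>
  All sums are taken in \<^typ>\<open>ennreal\<close>, so they always exist, and neither the collection
  nor the fibres are presupposed to be finite. Subtraction on \<^typ>\<open>ennreal\<close> is truncated at 0
  and satisfies \<open>\<infinity> - 1 = \<infinity>\<close>.
\<close>

definition fcip_relative ::
    "('a, 'b) monoid_scheme \<Rightarrow> 'i set \<Rightarrow> ('i \<Rightarrow> 'a set) \<Rightarrow> bool" where
  "fcip_relative G I A \<longleftrightarrow>
     (\<forall>B C. fg_subgroup G B \<and> fg_subgroup G C \<longrightarrow>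
       (\<forall>\<F> \<G>.
          (\<forall>i\<in>I. finite (\<F> i) \<and> \<F> i \<subseteq> carrier G \<and> inj_on (\<lambda>f. dcoset G B f (A i)) (\<F> i)) \<and>
          (\<forall>i\<in>I. finite (\<G> i) \<and> \<G> i \<subseteq> carrier G \<and> inj_on (\<lambda>g. dcoset G C g (A i)) (\<G> i)) \<longrightarrow>
          (\<Sum>\<^sub>\<infinity>D\<in>dcosets G B C.
             max 0 ((\<Sum>\<^sub>\<infinity>i\<in>I. \<Sum>f\<in>\<F> i. \<Sum>g\<in>\<G> i. ecard (coset_map_fibre G (A i) B C f g D)) - 1))
          < \<infinity>))"

lemma mem_conjugate: "x \<in> conjugate G H g \<longleftrightarrow> (\<exists>h\<in>H. x = inv\<^bsub>G\<^esub> g \<otimes>\<^bsub>G\<^esub> h \<otimes>\<^bsub>G\<^esub> g)"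
  unfolding conjugate_def r_coset_def l_coset_def by auto

lemma mem_dcoset: "x \<in> dcoset G H g K \<longleftrightarrow> (\<exists>h\<in>H. \<exists>k\<in>K. x = h \<otimes>\<^bsub>G\<^esub> g \<otimes>\<^bsub>G\<^esub> k)"
  unfolding dcoset_def r_coset_def set_mult_def by auto

lemma (in group) dcoset_absorb:
  assumes H: "subgroup H G" and K: "subgroup K G" and g: "g \<in> carrier G"
    and h: "h \<in> H" and k: "k \<in> K"
  shows "dcoset G H (h \<otimes> g \<otimes> k) K = dcoset G H g K"
proof -
  have hc: "h \<in> carrier G" and kc: "k \<in> carrier G"
    using H K h k by (auto dest: subgroup.mem_carrier)
  have "dcoset G H (h \<otimes> g \<otimes> k) K = (H #> (h \<otimes> (g \<otimes> k))) <#> K"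
    using hc kc g by (simp add: dcoset_def m_assoc)
  also have "\<dots> = ((H #> h) #> (g \<otimes> k)) <#> K"
    using hc kc g H by (simp add: coset_mult_assoc subgroup.subset)
  also have "\<dots> = ((H #> g) #> k) <#> K"
    using hc kc g H h by (simp add: coset_mult_assoc subgroup.subset subgroup.rcos_const)
  also have "\<dots> = (H #> g) <#> (k <#\<^bsub>G\<^esub> K)"
    using set_mult_assoc[of "H #> g" "{k}" K] g kc H K
    by (metis empty_subsetI insert_subset l_coset_eq_set_mult r_coset_eq_set_mult
        r_coset_subset_G subgroup.subset)
  also have "\<dots> = dcoset G H g K"
    using K k kc by (simp add: dcoset_def coset_join3)
  finally show ?thesis .
qed

lemma (in group) coset_map_dcoset:
  assumes A: "subgroup A G" and B: "subgroup B G" and C: "subgroup C G"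
    and f: "f \<in> carrier G" and g: "g \<in> carrier G" and a: "a \<in> A"
  shows "coset_map G B C f g (dcoset G (A \<inter> conjugate G B f) a (A \<inter> conjugate G C g))
       = dcoset G B (f \<otimes> a \<otimes> inv g) C"
proof -
  let ?X = "dcoset G (A \<inter> conjugate G B f) a (A \<inter> conjugate G C g)"
  let ?q = "\<lambda>x. dcoset G B (f \<otimes> x \<otimes> inv g) C"
  have ac: "a \<in> carrier G" using A a by (rule subgroup.mem_carrier)
  have "?q x = ?q a" if "x \<in> ?X" for x
  proof -
    from that obtain b c where b: "b \<in> B" and c: "c \<in> C"
      and x: "x = (inv f \<otimes> b \<otimes> f) \<otimes> a \<otimes> (inv g \<otimes> c \<otimes> g)"
      by (auto simp: mem_dcoset mem_conjugate)
    have bc: "b \<in> carrier G" and cc: "c \<in> carrier G"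
      using B C b c by (auto dest: subgroup.mem_carrier)
    have cancel: "h \<otimes> (inv h \<otimes> y) = y" if "h \<in> carrier G" "y \<in> carrier G" for h y
      using that by (simp flip: m_assoc)
    have "f \<otimes> x \<otimes> inv g = b \<otimes> (f \<otimes> a \<otimes> inv g) \<otimes> c"
      using bc cc ac f g by (simp add: x m_assoc cancel)
    then show ?thesis
      using dcoset_absorb[OF B C _ b c] ac f g by simp
  qed
  moreover have "a \<in> ?X"
  proof -
    have "\<one> \<in> conjugate G H k" if "subgroup H G" "k \<in> carrier G" for H k
      using that by (auto simp: mem_conjugate intro!: bexI[of _ \<one>] subgroup.one_closed)
    then show ?thesis
      using A B C f g ac
      by (auto simp: mem_dcoset subgroup.one_closed intro!: bexI[of _ \<one>])
  qed
  ultimately have "?q ` ?X = {?q a}" by blast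
  then show ?thesis by (simp add: coset_map_def)
qed

end

theory Submission
  imports Defs
begin

text \<open>
  Both parts of the theorem come from a single finiteness statement. Suppose that
  \<open>a = b u a' v c\<close> with \<open>a \<in> A\<close>, \<open>b \<in> B\<close>, \<open>a' \<in> A'\<close>, \<open>c \<in> C\<close>, where \<open>u\<close> and \<open>v\<close> are fixed
  and all four subgroups are quasi-convex. The factorization is a hexagon with vertices \<open>1\<close>,
  \<open>b\<close>, \<open>b u\<close>, \<open>b u a'\<close>, \<open>b u a' v\<close>, \<open>a\<close>, two of whose sides have fixed length. Hexagons in a
  hyperbolic group are slim, so a geodesic from \<open>1\<close> to \<open>a\<close>, which runs near \<open>A\<close>, consists of
  points near \<open>B\<close>, points near \<open>b u A'\<close> and points near \<open>a C\<close>. A point near both \<open>A\<close> and \<open>B\<close>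
  is near \<open>A \<inter> B\<close>, and a point near both \<open>A\<close> and \<open>a C\<close> is near \<open>a (A \<inter> C)\<close>
  (\<open>nbhd_Int_subgroup\<close>). Hence, if \<open>a\<close> is a shortest element of its double coset
  \<open>(A \<inter> B) a (A \<inter> C)\<close>, points of the first kind are near \<open>1\<close> and points of the third kind are
  near \<open>a\<close>. What remains in the middle lies near both \<open>A\<close> and the translate \<open>b u A'\<close>. If
  \<open>A\<close> meets the conjugate of \<open>A'\<close> by \<open>b u\<close> in a finite set, then the number of such points is
  bounded, with a bound that does not depend on \<open>b\<close>
  (\<open>bounded_overlap_of_translates\<close>). So the length of \<open>a\<close> is bounded, and only finitely many
  double cosets occur (\<open>short_double_coset_representatives\<close>).

  The relative f.g.i.p. is the case \<open>A' = A\<close>, \<open>u = v = 1\<close>: an element \<open>x = g\<inverse> h g\<close> of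
  \<open>H\<^sup>g \<inter> K\<close> with \<open>g \<in> A\<close> gives \<open>g = h\<inverse> g x\<close>, and \<open>x \<notin> A\<close> forces \<open>h \<notin> A\<close>, whence the required
  finiteness by almost malnormality. The f.g.i.p. itself is Howson's theorem for
  quasi-convex subgroups (\<open>quasiconvex_Int\<close>, \<open>quasiconvex_imp_fg\<close>).

  For the f.c.i.p., two double cosets, represented by \<open>a\<close> and \<open>a'\<close>, have the same image exactly when
  \<open>f a g\<inverse> = b f' a' g'\<inverse> c\<close> for some \<open>b \<in> B\<close> and \<open>c \<in> C\<close>; conjugating \<open>B\<close> by \<open>f\<close> and \<open>C\<close> by
  \<open>g\<close> gives the equation above. If the finiteness condition fails, almost malnormality says that
  the two members of the collection agree and that \<open>f\<inverse> b f'\<close> belongs to it. As the elements of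
  each of the given finite sets lie in distinct double cosets, it follows that \<open>f = f'\<close> and
  \<open>g = g'\<close>, and then that the two double cosets are equal (\<open>colliding_double_cosets\<close>). So only finitely many double cosets take
  part in a collision at all. This makes every fibre finite and all but finitely many fibres
  of size at most one.
\<close>

section \<open>The word metric\<close>

context group
begin

lemma inv_cancel_left:
  assumes "x \<in> carrier G" "y \<in> carrier G"
  shows "inv x \<otimes> (x \<otimes> y) = y" "x \<otimes> (inv x \<otimes> y) = y"
  using assms by (simp_all flip: m_assoc)

end

locale word_metric_group = group G for G (structure) +
  fixes S :: "'a set"
  assumes finite_S: "finite S" and S_carrier: "S \<subseteq> carrier G" and generate_S: "generate G S = carrier G"
begin

abbreviation d :: "'a \<Rightarrow> 'a \<Rightarrow> nat" where "d \<equiv> word_dist G S"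

abbreviation Cay :: "('a \<times> 'a) set" where "Cay \<equiv> cayley_graph G S"

lemma Cay_sym: "(x, y) \<in> Cay \<Longrightarrow> (y, x) \<in> Cay"
  by (auto simp: cayley_graph_def)

lemma Cay_carrier: "(x, y) \<in> Cay \<Longrightarrow> x \<in> carrier G \<and> y \<in> carrier G"
  by (auto simp: cayley_graph_def)

lemma Cay_translate:
  assumes "g \<in> carrier G" "(x, y) \<in> Cay"
  shows "(g \<otimes> x, g \<otimes> y) \<in> Cay"
proof -
  obtain s where s: "s \<in> S" "y = x \<otimes> s \<or> x = y \<otimes> s" and c: "x \<in> carrier G" "y \<in> carrier G"
    using assms(2) by (auto simp: cayley_graph_def)
  have "g \<otimes> y = g \<otimes> x \<otimes> s \<or> g \<otimes> x = g \<otimes> y \<otimes> s"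
    using s S_carrier c assms(1) by (auto simp: m_assoc)
  then show ?thesis using s c assms(1) by (auto simp: cayley_graph_def)
qed

lemma relpow_Cay_sym: "(x, y) \<in> Cay ^^ n \<Longrightarrow> (y, x) \<in> Cay ^^ n"
proof (induction n arbitrary: y)
  case (Suc n)
  then show ?case by (meson relpow_Suc_E relpow_Suc_I2 Cay_sym)
qed simp

lemma relpow_Cay_translate:
  assumes "g \<in> carrier G"
  shows "(x, y) \<in> Cay ^^ n \<Longrightarrow> (g \<otimes> x, g \<otimes> y) \<in> Cay ^^ n"
proof (induction n arbitrary: y)
  case (Suc n)
  then show ?case using Cay_translate[OF assms] by (meson relpow_Suc_E relpow_Suc_I)
qed simp

lemma relpow_Cay_carrier: "(x, y) \<in> Cay ^^ n \<Longrightarrow> x \<in> carrier G \<Longrightarrow> y \<in> carrier G"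
  by (cases n) (auto dest: Cay_carrier)

lemma Cay_connected:
  assumes x: "x \<in> carrier G" and y: "y \<in> carrier G"
  shows "(x, y) \<in> Cay\<^sup>*"
proof -
  have gen: "(x, x \<otimes> g) \<in> Cay\<^sup>*" if "g \<in> generate G S" "x \<in> carrier G" for g x
    using that
  proof (induction arbitrary: x)
    case one
    then show ?case by simp
  next
    case (incl h)
    then show ?case using S_carrier
      by (intro r_into_rtrancl) (auto simp: cayley_graph_def)
  next
    case (inv h)
    then have "x = x \<otimes> inv h \<otimes> h" "h \<in> carrier G" using S_carrier by (auto simp: m_assoc)
    then show ?case using inv
      by (intro r_into_rtrancl) (auto simp: cayley_graph_def)
  next
    case (eng h1 h2)
    then have c: "h1 \<in> carrier G" "h2 \<in> carrier G" using generate_S by auto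
    then have "(x, x \<otimes> h1) \<in> Cay\<^sup>*" "(x \<otimes> h1, x \<otimes> h1 \<otimes> h2) \<in> Cay\<^sup>*"
      using eng by auto
    then show ?case using c eng.prems by (simp add: m_assoc)
  qed
  have "inv x \<otimes> y \<in> generate G S" using generate_S x y by auto
  from gen[OF this x] show ?thesis using x y by (simp add: inv_cancel_left)
qed

lemma relpow_word_dist:
  assumes "x \<in> carrier G" "y \<in> carrier G"
  shows "(x, y) \<in> Cay ^^ d x y"
  unfolding word_dist_def using Cay_connected[OF assms] by (metis LeastI rtrancl_imp_relpow)

lemma word_dist_le: "(x, y) \<in> Cay ^^ n \<Longrightarrow> d x y \<le> n"
  unfolding word_dist_def by (rule Least_le)

lemma word_dist_sym:
  assumes "x \<in> carrier G" "y \<in> carrier G"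
  shows "d x y = d y x"
  using word_dist_le[OF relpow_Cay_sym[OF relpow_word_dist[OF assms]]]
    word_dist_le[OF relpow_Cay_sym[OF relpow_word_dist[OF assms(2,1)]]] by (rule antisym[rotated])

lemma word_dist_triangle:
  assumes "x \<in> carrier G" "y \<in> carrier G" "z \<in> carrier G"
  shows "d x z \<le> d x y + d y z"
  using assms by (intro word_dist_le) (auto simp: relpow_add intro!: relpow_word_dist)

lemma word_dist_self [simp]: "d x x = 0"
  using word_dist_le[of x x 0] by simp

lemma word_dist_translate:
  assumes "g \<in> carrier G" "x \<in> carrier G" "y \<in> carrier G"
  shows "d (g \<otimes> x) (g \<otimes> y) = d x y"
proof (rule antisym)
  show "d (g \<otimes> x) (g \<otimes> y) \<le> d x y"
    using assms by (intro word_dist_le relpow_Cay_translate relpow_word_dist)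
  have "(inv g \<otimes> (g \<otimes> x), inv g \<otimes> (g \<otimes> y)) \<in> Cay ^^ d (g \<otimes> x) (g \<otimes> y)"
    using assms by (intro relpow_Cay_translate relpow_word_dist) auto
  then show "d x y \<le> d (g \<otimes> x) (g \<otimes> y)"
    using assms by (intro word_dist_le) (simp add: inv_cancel_left)
qed

lemma word_dist_eq_length:
  assumes "x \<in> carrier G" "y \<in> carrier G"
  shows "d x y = d \<one> (inv x \<otimes> y)"
  using word_dist_translate[OF inv_closed[OF assms(1)] assms] assms(1) by simp

lemma word_length_inv:
  assumes "x \<in> carrier G"
  shows "d \<one> (inv x) = d \<one> x"
proof -
  have "d \<one> x = d x \<one>" using assms by (intro word_dist_sym) auto
  also have "\<dots> = d \<one> (inv x \<otimes> \<one>)" using assms by (intro word_dist_eq_length) auto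
  finally show ?thesis using assms by simp
qed

definition ball_at_one :: "nat \<Rightarrow> 'a set" where
  "ball_at_one n = {x \<in> carrier G. d \<one> x \<le> n}"

lemma finite_ball_at_one: "finite (ball_at_one n)"
proof -
  have sphere: "finite {y. (\<one>, y) \<in> Cay ^^ k}" for k
  proof (induction k)
    case (Suc k)
    let ?Y = "{y. (\<one>, y) \<in> Cay ^^ k}"
    have "{y. (\<one>, y) \<in> Cay ^^ Suc k} \<subseteq>
      (\<lambda>(y, s). y \<otimes> s) ` (?Y \<times> S) \<union> (\<lambda>(y, s). y \<otimes> inv s) ` (?Y \<times> S)"
    proof
      fix z assume "z \<in> {y. (\<one>, y) \<in> Cay ^^ Suc k}"
      then obtain y where y: "(\<one>, y) \<in> Cay ^^ k" and yz: "(y, z) \<in> Cay" by auto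
      then obtain s where s: "s \<in> S" "z = y \<otimes> s \<or> y = z \<otimes> s" "y \<in> carrier G" "z \<in> carrier G"
        by (auto simp: cayley_graph_def)
      then have "z = y \<otimes> s \<or> z = y \<otimes> inv s" using S_carrier by (auto simp: m_assoc)
      with y s(1) show "z \<in> (\<lambda>(y, s). y \<otimes> s) ` (?Y \<times> S) \<union> (\<lambda>(y, s). y \<otimes> inv s) ` (?Y \<times> S)"
        by force
    qed
    then show ?case using Suc finite_S by (meson finite_SigmaI finite_UnI finite_imageI finite_subset)
  qed simp
  have "ball_at_one n \<subseteq> (\<Union>k\<le>n. {y. (\<one>, y) \<in> Cay ^^ k})"
    using relpow_word_dist[OF one_closed] by (auto simp: ball_at_one_def)
  then show ?thesis by (rule finite_subset) (auto intro: sphere)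
qed


section \<open>Intervals instead of geodesics\<close>

text \<open>
  The union of all geodesics from \<open>x\<close> to \<open>y\<close> (see \<open>on_geodesic_iff_interval\<close>). Slimness of triangles and
  quasi-convexity only speak of points that lie on some geodesic, so they can be restated with intervals,
  which are symmetric and invariant under translation for plain arithmetical reasons.
\<close>

definition interval :: "'a \<Rightarrow> 'a \<Rightarrow> 'a set" where
  "interval x y = {u \<in> carrier G. d x u + d u y = d x y}"

lemma interval_sym:
  assumes "x \<in> carrier G" "y \<in> carrier G"
  shows "interval x y = interval y x"
proof -
  have "d x u + d u y = d y u + d u x" if "u \<in> carrier G" for u
    using word_dist_sym[OF assms(1) that] word_dist_sym[OF that assms(2)] by linarith
  moreover have "d x y = d y x" using assms by (rule word_dist_sym)
  ultimately show ?thesis by (auto simp: interval_def)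
qed

lemma interval_translate:
  assumes "g \<in> carrier G" "x \<in> carrier G" "y \<in> carrier G" "u \<in> interval x y"
  shows "g \<otimes> u \<in> interval (g \<otimes> x) (g \<otimes> y)"
  using assms by (auto simp: interval_def word_dist_translate)

lemma interval_point_at:
  assumes x: "x \<in> carrier G" and y: "y \<in> carrier G" and k: "k \<le> d x y"
  obtains u where "u \<in> interval x y" "d x u = k" "d u y = d x y - k"
proof -
  have "(x, y) \<in> Cay ^^ (k + (d x y - k))" using relpow_word_dist[OF x y] k by simp
  then obtain u where u: "(x, u) \<in> Cay ^^ k" "(u, y) \<in> Cay ^^ (d x y - k)"
    unfolding relpow_add by auto
  have uc: "u \<in> carrier G" using u(1) x by (rule relpow_Cay_carrier)
  have "d x u \<le> k" "d u y \<le> d x y - k" using u word_dist_le by auto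
  with word_dist_triangle[OF x uc y] k have "d x u = k" "d u y = d x y - k" by auto
  with uc k show ?thesis by (intro that[of u]) (auto simp: interval_def)
qed

text \<open>
  The \<open>i\<close>-th vertex of a geodesic is at distance at most \<open>i\<close> from its start and at most \<open>n - i\<close> from its
  end, and by the triangle inequality both are equalities. Conversely two shortest paths through a point
  of the interval concatenate to a path of the right length.
\<close>

lemma on_geodesic_iff_interval:
  assumes x: "x \<in> carrier G" and y: "y \<in> carrier G"
  shows "(\<exists>p. geodesic G S x p y \<and> u \<in> set p) \<longleftrightarrow> u \<in> interval x y"
proof
  assume "\<exists>p. geodesic G S x p y \<and> u \<in> set p"
  then obtain p where p: "p \<noteq> []" "hd p = x" "last p = y" "set p \<subseteq> carrier G"
    "successively (\<lambda>u v. (u, v) \<in> Cay) p" "length p = Suc (d x y)" and u: "u \<in> set p"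
    by (auto simp: geodesic_def)
  let ?n = "d x y"
  obtain i where i: "i \<le> ?n" "u = p ! i" using u p(6) by (auto simp: in_set_conv_nth less_Suc_eq_le)
  have step: "(p ! j, p ! Suc j) \<in> Cay" if "j < ?n" for j
    using p(5,6) that by (auto simp: successively_conv_nth)
  have ends: "p ! 0 = x" "p ! ?n = y"
    using p by (auto simp: hd_conv_nth last_conv_nth)
  have "(x, u) \<in> Cay ^^ i" unfolding relpow_fun_conv
    by (rule exI[of _ "\<lambda>j. p ! j"]) (use i ends step in auto)
  moreover have "(u, y) \<in> Cay ^^ (?n - i)" unfolding relpow_fun_conv
    by (rule exI[of _ "\<lambda>j. p ! (i + j)"]) (use i ends step in auto)
  ultimately have "d x u \<le> i" "d u y \<le> ?n - i" using word_dist_le by auto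
  moreover have uc: "u \<in> carrier G" using u p by auto
  ultimately show "u \<in> interval x y" using word_dist_triangle[OF x uc y] i
    by (auto simp: interval_def)
next
  assume u: "u \<in> interval x y"
  then have uc: "u \<in> carrier G" and eq: "d x u + d u y = d x y" by (auto simp: interval_def)
  obtain f where f: "f 0 = x" "f (d x u) = u" "\<And>i. i < d x u \<Longrightarrow> (f i, f (Suc i)) \<in> Cay"
    using relpow_word_dist[OF x uc] unfolding relpow_fun_conv by auto
  obtain g where g: "g 0 = u" "g (d u y) = y" "\<And>i. i < d u y \<Longrightarrow> (g i, g (Suc i)) \<in> Cay"
    using relpow_word_dist[OF uc y] unfolding relpow_fun_conv by auto
  define h where "h i = (if i < d x u then f i else g (i - d x u))" for i
  have h: "h 0 = x" "h (d x y) = y" "h (d x u) = u"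
    using f(1,2) g(1,2) unfolding eq[symmetric] by (auto simp: h_def)
  have step: "(h i, h (Suc i)) \<in> Cay" if i: "i < d x y" for i
  proof -
    consider "Suc i < d x u" | "Suc i = d x u" | "i \<ge> d x u" by linarith
    then show ?thesis
    proof cases
      case 2
      then show ?thesis using f(2) f(3)[of i] g(1) by (auto simp: h_def)
    next
      case 3
      then show ?thesis using g(3)[of "i - d x u"] i eq by (auto simp: h_def Suc_diff_le)
    qed (auto simp: h_def f)
  qed
  define p where "p = map h [0..<Suc (d x y)]"
  have pc: "h i \<in> carrier G" if "i \<le> d x y" for i
    using that
  proof (induction i)
    case (Suc i)
    then show ?case using step[of i] Cay_carrier by auto
  qed (simp add: x h(1))
  have "geodesic G S x p y" unfolding geodesic_def
  proof (intro conjI)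
    show "successively (\<lambda>u v. (u, v) \<in> Cay) p"
      using step by (auto simp: p_def successively_conv_nth simp del: upt_Suc)
    show "hd p = x" by (simp add: p_def hd_map h del: upt_Suc)
    show "last p = y" by (simp add: p_def h)
    show "set p \<subseteq> carrier G" using pc by (auto simp: p_def simp del: upt_Suc)
  qed (auto simp: p_def)
  moreover have "u \<in> set p" unfolding p_def using h(3) eq
    by (auto simp del: upt_Suc intro!: image_eqI[of _ _ "d x u"])
  ultimately show "\<exists>p. geodesic G S x p y \<and> u \<in> set p" by blast
qed

definition nbhd :: "'a set \<Rightarrow> nat \<Rightarrow> 'a set" where
  "nbhd X r = {u \<in> carrier G. \<exists>x\<in>X. d u x \<le> r}"

lemma nbhd_mono: "r \<le> r' \<Longrightarrow> nbhd X r \<subseteq> nbhd X r'"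
  by (force simp: nbhd_def)

lemma nbhd_nbhd:
  assumes "X \<subseteq> carrier G" "u \<in> carrier G" "v \<in> nbhd X r" "d u v \<le> s"
  shows "u \<in> nbhd X (s + r)"
proof -
  obtain x where x: "x \<in> X" "d v x \<le> r" "v \<in> carrier G" using assms by (auto simp: nbhd_def)
  then show ?thesis using assms word_dist_triangle[of u v x] by (force simp: nbhd_def)
qed

lemma nbhd_translate:
  assumes "X \<subseteq> carrier G" "g \<in> carrier G" "u \<in> nbhd X r"
  shows "g \<otimes> u \<in> nbhd (g <# X) r"
proof -
  obtain x where x: "x \<in> X" "d u x \<le> r" "u \<in> carrier G" using assms by (auto simp: nbhd_def)
  then have "d (g \<otimes> u) (g \<otimes> x) \<le> r" using assms word_dist_translate[of g u x] by auto
  then show ?thesis using x assms by (auto simp: nbhd_def l_coset_def)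
qed

definition quasiconvex :: "'a set \<Rightarrow> bool" where
  "quasiconvex H \<longleftrightarrow> subgroup H G \<and> (\<exists>\<kappa>. \<forall>h\<in>H. \<forall>k\<in>H. interval h k \<subseteq> nbhd H \<kappa>)"

lemma quasiconvex_subgroup: "quasiconvex H \<Longrightarrow> subgroup H G"
  by (simp add: quasiconvex_def)

text \<open>One constant serves finitely many subgroups; this keeps the estimates for hexagons readable.\<close>

lemma quasiconvex_uniform:
  assumes fin: "finite \<X>" and q: "\<And>X. X \<in> \<X> \<Longrightarrow> quasiconvex X"
  obtains \<kappa> where "\<And>X h k. X \<in> \<X> \<Longrightarrow> h \<in> X \<Longrightarrow> k \<in> X \<Longrightarrow> interval h k \<subseteq> nbhd X \<kappa>"
proof -
  have "\<forall>X\<in>\<X>. \<exists>\<kappa>. \<forall>h\<in>X. \<forall>k\<in>X. interval h k \<subseteq> nbhd X \<kappa>"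
    using q unfolding quasiconvex_def by blast
  then obtain \<kappa> where \<kappa>: "\<forall>X\<in>\<X>. \<forall>h\<in>X. \<forall>k\<in>X. interval h k \<subseteq> nbhd X (\<kappa> X)"
    unfolding bchoice_iff by blast
  have "interval h k \<subseteq> nbhd X (Max (\<kappa> ` \<X>))" if X: "X \<in> \<X>" and hk: "h \<in> X" "k \<in> X" for X h k
  proof -
    have "\<kappa> X \<le> Max (\<kappa> ` \<X>)" using X fin by simp
    from nbhd_mono[OF this, of X] \<kappa>[rule_format, OF X hk] show ?thesis by (rule order_trans[rotated])
  qed
  then show ?thesis by (rule that)
qed

lemma quasiconvexI:
  assumes H: "subgroup H G" and q: "quasiconvex_wrt G S H"
  shows "quasiconvex H"
proof -
  obtain \<kappa> where \<kappa>: "\<And>h k p u. h \<in> H \<Longrightarrow> k \<in> H \<Longrightarrow> geodesic G S h p k \<Longrightarrow> u \<in> set p \<Longrightarrow> \<exists>v\<in>H. d u v \<le> \<kappa>"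
    using q unfolding quasiconvex_wrt_def by blast
  have "interval h k \<subseteq> nbhd H \<kappa>" if hk: "h \<in> H" "k \<in> H" for h k
  proof
    fix u assume u: "u \<in> interval h k"
    then obtain p where "geodesic G S h p k" "u \<in> set p"
      using on_geodesic_iff_interval[of h k u] subgroup.mem_carrier[OF H] hk by auto
    with \<kappa> hk u show "u \<in> nbhd H \<kappa>" by (fastforce simp: nbhd_def interval_def)
  qed
  then show ?thesis using H unfolding quasiconvex_def by blast
qed

definition slim :: "nat \<Rightarrow> bool" where
  "slim \<delta> \<longleftrightarrow> (\<forall>x\<in>carrier G. \<forall>y\<in>carrier G. \<forall>z\<in>carrier G.
     \<forall>u\<in>interval x y. \<exists>v\<in>interval x z \<union> interval z y. d u v \<le> \<delta>)"

lemma hyperbolic_imp_slim: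
  assumes "hyperbolic_wrt G S"
  shows "\<exists>\<delta>. slim \<delta>"
proof -
  obtain \<delta> where \<delta>: "\<And>x y z p q r u. geodesic G S x p y \<Longrightarrow> geodesic G S y q z \<Longrightarrow> geodesic G S z r x \<Longrightarrow>
      u \<in> set p \<Longrightarrow> \<exists>v\<in>set q \<union> set r. d u v \<le> \<delta>"
    using assms unfolding hyperbolic_wrt_def by blast
  have ex: "\<exists>p. geodesic G S x p y" if "x \<in> carrier G" "y \<in> carrier G" for x y
    using on_geodesic_iff_interval[OF that, of x] that by (auto simp: interval_def)
  have "slim \<delta>" unfolding slim_def
  proof (intro ballI)
    fix x y z u assume c: "x \<in> carrier G" "y \<in> carrier G" "z \<in> carrier G" and u: "u \<in> interval x y"
    obtain p where p: "geodesic G S x p y" "u \<in> set p"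
      using on_geodesic_iff_interval[OF c(1,2)] u by blast
    obtain q r where qr: "geodesic G S y q z" "geodesic G S z r x" using ex c by meson
    obtain v where v: "v \<in> set q \<union> set r" "d u v \<le> \<delta>" using \<delta>[OF p(1) qr p(2)] by auto
    have "v \<in> interval y z \<union> interval z x"
      using v(1) on_geodesic_iff_interval[OF c(2,3), of v] on_geodesic_iff_interval[OF c(3,1), of v] qr
      by blast
    then show "\<exists>v\<in>interval x z \<union> interval z y. d u v \<le> \<delta>" using interval_sym c v(2) by blast
  qed
  then show ?thesis ..
qed

text \<open>
  Cut the polygon into triangles by the diagonals that end at the last vertex; each triangle costs \<open>\<delta>\<close>.
\<close>

lemma slim_polygon:
  assumes \<delta>: "slim \<delta>"
  shows "x \<in> carrier G \<Longrightarrow> vs \<noteq> [] \<Longrightarrow> set vs \<subseteq> carrier G \<Longrightarrow> u \<in> interval x (last vs) \<Longrightarrow>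
    \<exists>(y, z)\<in>set (zip (x # vs) vs). \<exists>v\<in>interval y z. d u v \<le> \<delta> * length vs"
proof (induction vs arbitrary: x u)
  case (Cons z vs)
  show ?case
  proof (cases "vs = []")
    case True
    then show ?thesis using Cons.prems by (auto intro!: bexI[of _ u])
  next
    case False
    let ?y = "last vs"
    have yc: "?y \<in> carrier G" and zc: "z \<in> carrier G" using Cons.prems False by auto
    have uc: "u \<in> carrier G" and u: "u \<in> interval x ?y" using Cons.prems False by (auto simp: interval_def)
    then obtain v where v: "v \<in> interval x z \<union> interval z ?y" "d u v \<le> \<delta>"
      using \<delta> Cons.prems(1) yc zc unfolding slim_def by blast
    show ?thesis
    proof (cases "v \<in> interval x z")
      case True
      then show ?thesis using v(2) by (auto intro!: bexI[of _ v])
    next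
      case False
      then have vi: "v \<in> interval z ?y" using v by auto
      obtain a b w where w: "(a, b) \<in> set (zip (z # vs) vs)" "w \<in> interval a b" "d v w \<le> \<delta> * length vs"
        using Cons.IH[OF zc \<open>vs \<noteq> []\<close> _ vi] Cons.prems(3) by auto
      have "v \<in> carrier G" "w \<in> carrier G" using vi w by (auto simp: interval_def)
      then have "d u w \<le> \<delta> * length (z # vs)" using word_dist_triangle[of u v w] uc v(2) w(3) by auto
      with w show ?thesis by (auto intro!: bexI[of _ "(a, b)"] bexI[of _ w])
    qed
  qed
qed simp


section \<open>Intersections of quasi-convex subgroups\<close>

lemma nbhd_subgroup:
  assumes H: "subgroup H G" and u: "u \<in> nbhd H r"
  obtains h t where "h \<in> H" "t \<in> ball_at_one r" "u = h \<otimes> t"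
proof -
  obtain h where h: "h \<in> H" "d u h \<le> r" and uc: "u \<in> carrier G" using u by (auto simp: nbhd_def)
  have hc: "h \<in> carrier G" using subgroup.mem_carrier[OF H h(1)] .
  have "d \<one> (inv h \<otimes> u) \<le> r"
    using h(2) word_dist_eq_length[OF hc uc] word_dist_sym[OF hc uc] by simp
  then show ?thesis using h(1) hc uc
    by (intro that[of h "inv h \<otimes> u"]) (auto simp: ball_at_one_def inv_cancel_left)
qed

text \<open>
  A point near both subgroups lies in \<open>H s \<inter> K t\<close> for some \<open>s\<close> and \<open>t\<close> in a fixed finite ball. If
  nonempty, such an intersection is a single coset of \<open>H \<inter> K\<close>, so its points are all as close to
  \<open>H \<inter> K\<close> as any chosen representative is to \<open>1\<close>; and there are finitely many pairs \<open>(s, t)\<close>.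
\<close>

lemma nbhd_Int_subgroup:
  assumes H: "subgroup H G" and K: "subgroup K G"
  shows "\<exists>R. nbhd H r \<inter> nbhd K r \<subseteq> nbhd (H \<inter> K) R"
proof -
  note Hc = subgroup.mem_carrier[OF H] and Kc = subgroup.mem_carrier[OF K]
  let ?b = "ball_at_one r"
  define rep where "rep s t = (SOME p. p \<in> (H #> s) \<inter> (K #> t))" for s t
  define R where "R = Max (insert 0 ((\<lambda>(s, t). d \<one> (rep s t)) ` (?b \<times> ?b)))"
  have "nbhd H r \<inter> nbhd K r \<subseteq> nbhd (H \<inter> K) R"
  proof
    fix p assume p: "p \<in> nbhd H r \<inter> nbhd K r"
    then have pc: "p \<in> carrier G" by (simp add: nbhd_def)
    obtain h s where h: "h \<in> H" "s \<in> ?b" "p = h \<otimes> s" using p nbhd_subgroup[OF H] by blast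
    obtain k t where k: "k \<in> K" "t \<in> ?b" "p = k \<otimes> t" using p nbhd_subgroup[OF K] by blast
    let ?q = "rep s t"
    have "p \<in> H #> s" using h unfolding r_coset_def by blast
    moreover have "p \<in> K #> t" using k unfolding r_coset_def by blast
    ultimately have "p \<in> (H #> s) \<inter> (K #> t)" ..
    then have "?q \<in> (H #> s) \<inter> (K #> t)" unfolding rep_def by (rule someI)
    then obtain h' k' where q: "h' \<in> H" "?q = h' \<otimes> s" "k' \<in> K" "?q = k' \<otimes> t"
      by (auto simp: r_coset_def)
    have sc: "s \<in> carrier G" and tc: "t \<in> carrier G" using h k by (auto simp: ball_at_one_def)
    let ?l = "p \<otimes> inv ?q"
    have qc: "?q \<in> carrier G" using q Hc sc by auto
    have "?l = h \<otimes> inv h'" unfolding q(2) h(3)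
      using Hc[OF h(1)] Hc[OF q(1)] sc by (simp add: m_assoc inv_mult_group inv_cancel_left)
    then have lH: "?l \<in> H" using H h q by (simp add: subgroup.m_closed subgroup.m_inv_closed)
    have "?l = k \<otimes> inv k'" unfolding q(4) k(3)
      using Kc[OF k(1)] Kc[OF q(3)] tc by (simp add: m_assoc inv_mult_group inv_cancel_left)
    then have lK: "?l \<in> K" using K k q by (simp add: subgroup.m_closed subgroup.m_inv_closed)
    have "d p ?l = d \<one> (inv ?q)" using word_dist_eq_length[of p ?l] pc qc by (simp add: inv_cancel_left)
    also have "\<dots> = d \<one> ?q" using qc by (rule word_length_inv)
    also have "\<dots> \<le> R" unfolding R_def using h(2) k(2) finite_ball_at_one
      by (intro Max_ge) auto
    finally show "p \<in> nbhd (H \<inter> K) R" using pc lH lK by (auto simp: nbhd_def)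
  qed
  then show ?thesis ..
qed

lemma quasiconvex_Int:
  assumes "quasiconvex H" "quasiconvex K"
  shows "quasiconvex (H \<inter> K)"
proof -
  obtain \<kappa> \<mu> where q: "\<And>h k. h \<in> H \<Longrightarrow> k \<in> H \<Longrightarrow> interval h k \<subseteq> nbhd H \<kappa>"
    "\<And>h k. h \<in> K \<Longrightarrow> k \<in> K \<Longrightarrow> interval h k \<subseteq> nbhd K \<mu>"
    and s: "subgroup H G" "subgroup K G"
    using assms unfolding quasiconvex_def by blast
  obtain R where R: "nbhd H (max \<kappa> \<mu>) \<inter> nbhd K (max \<kappa> \<mu>) \<subseteq> nbhd (H \<inter> K) R"
    using nbhd_Int_subgroup[OF s] by blast
  have "interval h k \<subseteq> nbhd (H \<inter> K) R" if "h \<in> H \<inter> K" "k \<in> H \<inter> K" for h k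
    using that q[of h k] R nbhd_mono[of \<kappa> "max \<kappa> \<mu>" H] nbhd_mono[of \<mu> "max \<kappa> \<mu>" K] by fastforce
  then show ?thesis using subgroups_Inter_pair[OF s] unfolding quasiconvex_def by blast
qed

text \<open>
  Walk along a geodesic from \<open>1\<close> to \<open>x \<in> L\<close>. Elements of \<open>L\<close> near consecutive vertices differ by an element
  of \<open>L\<close> of length at most \<open>2 \<kappa> + 1\<close>, and \<open>x\<close> is the product of these differences.
\<close>

lemma quasiconvex_imp_fg:
  assumes "quasiconvex L"
  shows "fg_subgroup G L"
proof -
  obtain \<kappa> where L: "subgroup L G" and \<kappa>: "\<And>h k. h \<in> L \<Longrightarrow> k \<in> L \<Longrightarrow> interval h k \<subseteq> nbhd L \<kappa>"
    using assms unfolding quasiconvex_def by blast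
  note Lc = subgroup.mem_carrier[OF L]
  define T where "T = L \<inter> ball_at_one (2 * \<kappa> + 1)"
  have TL: "T \<subseteq> L" and Tc: "T \<subseteq> carrier G" using Lc by (auto simp: T_def)
  have "x \<in> generate G T" if x: "x \<in> L" for x
  proof -
    \<comment> \<open>Quantifying over every \<open>l\<close> near \<open>u\<close> allows the choice \<open>u = l = x\<close> at the end.\<close>
    have step: "l \<in> generate G T"
      if "u \<in> interval \<one> x" "d \<one> u = n" "l \<in> L" "d u l \<le> \<kappa>" for n u l
      using that
    proof (induction n arbitrary: u l)
      case 0
      have c: "u \<in> carrier G" "l \<in> carrier G" using 0 Lc by (auto simp: interval_def)
      have "d \<one> l \<le> \<kappa>" using word_dist_triangle[of \<one> u l] 0 c by simp
      then have "l \<in> T" using 0 c by (auto simp: T_def ball_at_one_def)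
      then show ?case by (rule generate.incl)
    next
      case (Suc n)
      have c: "u \<in> carrier G" "l \<in> carrier G" "x \<in> carrier G" using Suc.prems Lc x by (auto simp: interval_def)
      obtain u' where u': "u' \<in> interval \<one> u" "d \<one> u' = n" "d u' u = 1"
        using interval_point_at[of \<one> u n] Suc.prems c by auto
      have u'c: "u' \<in> carrier G" using u' by (simp add: interval_def)
      have "u' \<in> interval \<one> x"
        using word_dist_triangle[OF u'c c(1,3)] word_dist_triangle[OF one_closed u'c c(3)] u' Suc.prems u'c
        by (auto simp: interval_def)
      moreover obtain l' where l': "l' \<in> L" "d u' l' \<le> \<kappa>"
        using \<kappa>[OF subgroup.one_closed[OF L] x] \<open>u' \<in> interval \<one> x\<close> by (auto simp: nbhd_def)
      ultimately have gl': "l' \<in> generate G T" using Suc.IH u' by blast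
      have l'c: "l' \<in> carrier G" using l' Lc by auto
      have "d l' l \<le> d l' u' + d u' u + d u l"
        using word_dist_triangle[OF l'c u'c c(2)] word_dist_triangle[OF u'c c(1) c(2)] by linarith
      also have "\<dots> \<le> 2 * \<kappa> + 1" using l'(2) u'(3) Suc.prems word_dist_sym[OF l'c u'c] by linarith
      finally have "inv l' \<otimes> l \<in> T" using word_dist_eq_length[OF l'c c(2)] l'c c l' Suc.prems L
        by (auto simp: T_def ball_at_one_def subgroup.m_closed subgroup.m_inv_closed)
      then have "l' \<otimes> (inv l' \<otimes> l) \<in> generate G T" using gl' generate.incl generate.eng by metis
      then show ?case using l'c c by (simp add: inv_cancel_left)
    qed
    show ?thesis
      by (rule step[of x "d \<one> x"]) (use x Lc in \<open>auto simp: interval_def\<close>)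
  qed
  moreover have "generate G T \<subseteq> L" using generate_subgroup_incl[OF TL L] .
  ultimately have "generate G T = L" by auto
  moreover have "finite T" using finite_ball_at_one by (simp add: T_def)
  ultimately show ?thesis using L Tc unfolding fg_subgroup_def by blast
qed

section \<open>Overlaps of translates and short representatives of double cosets\<close>

text \<open>
  With \<open>inv w\<close> in the role of the conjugating element, \<open>conjugate G A' (inv w)\<close> is \<open>w A' w\<inverse>\<close>. Its
  intersection with \<open>A\<close> depends, up to conjugation inside \<open>A\<close>, only on the double coset \<open>A w A'\<close>.
\<close>

lemma finite_Int_conjugate_double_coset:
  assumes A: "subgroup A G" and A': "subgroup A' G" and w: "w \<in> carrier G"
    and x: "x \<in> A" and y: "y \<in> A'" and fin: "finite (A \<inter> conjugate G A' (inv w))"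
  shows "finite (A \<inter> conjugate G A' (inv (x \<otimes> w \<otimes> y)))"
proof -
  let ?w = "x \<otimes> w \<otimes> y"
  note Ac = subgroup.mem_carrier[OF A] and A'c = subgroup.mem_carrier[OF A']
  have xc: "x \<in> carrier G" and yc: "y \<in> carrier G" using x y Ac A'c by auto
  have "inj_on (\<lambda>z. inv x \<otimes> z \<otimes> x) (A \<inter> conjugate G A' (inv ?w))"
    using Ac xc by (auto simp: inj_on_def)
  moreover have "inv x \<otimes> z \<otimes> x \<in> A \<inter> conjugate G A' (inv w)" if z: "z \<in> A \<inter> conjugate G A' (inv ?w)" for z
  proof -
    obtain h where h: "h \<in> A'" "z = ?w \<otimes> h \<otimes> inv ?w"
      using z w xc yc by (auto simp: mem_conjugate)
    have hc: "h \<in> carrier G" using A'c h by auto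
    have "inv x \<otimes> z \<otimes> x = w \<otimes> (y \<otimes> h \<otimes> inv y) \<otimes> inv w"
      unfolding h(2) using xc yc w hc by (simp add: m_assoc inv_mult_group inv_cancel_left)
    moreover have "y \<otimes> h \<otimes> inv y \<in> A'" using A' h y by (simp add: subgroup.m_closed subgroup.m_inv_closed)
    moreover have "inv x \<otimes> z \<otimes> x \<in> A" using A x z by (simp add: subgroup.m_closed subgroup.m_inv_closed)
    ultimately show ?thesis using w by (auto simp: mem_conjugate)
  qed
  ultimately show ?thesis using fin by (meson image_subsetI inj_on_finite)
qed

text \<open>
  The bound has to be uniform in \<open>w\<close>. If a point lies near \<open>A\<close> and near \<open>w A'\<close>, say at \<open>a s = w a' t\<close> with
  short \<open>s\<close> and \<open>t\<close>, then \<open>s t\<inverse>\<close> is in the double coset \<open>A w A'\<close>. The points with given \<open>s\<close> and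
  \<open>t\<close> therefore inject into \<open>A \<inter> (s t\<inverse>) A' (s t\<inverse>)\<inverse>\<close>, which does not mention \<open>w\<close>, and this set is finite
  because finiteness only depends on the double coset.
\<close>

lemma bounded_overlap_of_translates:
  assumes A: "subgroup A G" and A': "subgroup A' G"
  shows "\<exists>N. \<forall>w\<in>carrier G. finite (A \<inter> conjugate G A' (inv w)) \<longrightarrow>
    finite (nbhd A r \<inter> nbhd (w <# A') r) \<and> card (nbhd A r \<inter> nbhd (w <# A') r) \<le> N"
proof -
  note Ac = subgroup.mem_carrier[OF A] and A'c = subgroup.mem_carrier[OF A']
  let ?b = "ball_at_one r"
  define Y where "Y x = A \<inter> conjugate G A' (inv x)" for x
  \<comment> \<open>Infinite \<open>Y x\<close> contribute 0; they never arise as \<open>Y (s \<otimes> inv t)\<close> with \<open>Q w s t\<close> nonempty and \<open>Y w\<close> finite.\<close>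
  define N where "N = (\<Sum>(s, t)\<in>?b \<times> ?b. card (Y (s \<otimes> inv t)))"
  define Q where "Q w s t = {p. \<exists>a\<in>A. \<exists>a'\<in>A'. p = a \<otimes> s \<and> p = w \<otimes> a' \<otimes> t}" for w s t
  have bc: "s \<in> carrier G" if "s \<in> ?b" for s using that by (simp add: ball_at_one_def)
  have "finite (nbhd A r \<inter> nbhd (w <# A') r) \<and> card (nbhd A r \<inter> nbhd (w <# A') r) \<le> N"
    if w: "w \<in> carrier G" and fin: "finite (Y w)" for w
  proof -
    have cover: "nbhd A r \<inter> nbhd (w <# A') r \<subseteq> (\<Union>(s, t)\<in>?b \<times> ?b. Q w s t)"
    proof
      fix p assume p: "p \<in> nbhd A r \<inter> nbhd (w <# A') r"
      then have pc: "p \<in> carrier G" by (simp add: nbhd_def)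
      obtain a s where a: "a \<in> A" "s \<in> ?b" "p = a \<otimes> s" using p nbhd_subgroup[OF A] by blast
      have wA': "w <# A' \<subseteq> carrier G" using w A'c by (auto simp: l_coset_def)
      have "inv w <# (w <# A') = A'"
        using w A' by (simp add: lcos_m_assoc lcos_mult_one subgroup.subset)
      then have "inv w \<otimes> p \<in> nbhd A' r"
        using nbhd_translate[OF wA' inv_closed[OF w], of p r] p by simp
      then obtain a' t where a': "a' \<in> A'" "t \<in> ?b" "inv w \<otimes> p = a' \<otimes> t"
        using nbhd_subgroup[OF A'] by blast
      have "w \<otimes> (inv w \<otimes> p) = w \<otimes> (a' \<otimes> t)" by (simp add: a')
      then have "p = w \<otimes> a' \<otimes> t"
        using w pc A'c[OF a'(1)] bc[OF a'(2)] by (simp only: m_assoc inv_cancel_left m_closed)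
      with a a' show "p \<in> (\<Union>(s, t)\<in>?b \<times> ?b. Q w s t)" unfolding Q_def by blast
    qed
    have Q: "finite (Q w s t) \<and> card (Q w s t) \<le> card (Y (s \<otimes> inv t))" if "s \<in> ?b" "t \<in> ?b" for s t
    proof (cases "Q w s t = {}")
      case False
      then obtain a0 a0' where a0: "a0 \<in> A" "a0' \<in> A'" "a0 \<otimes> s = w \<otimes> a0' \<otimes> t"
        unfolding Q_def by auto
      have c: "a0 \<in> carrier G" "a0' \<in> carrier G" "s \<in> carrier G" "t \<in> carrier G"
        using a0 that Ac A'c bc by auto
      have "inv a0 \<otimes> (a0 \<otimes> s) \<otimes> inv t = inv a0 \<otimes> (w \<otimes> a0' \<otimes> t) \<otimes> inv t" by (simp add: a0)
      then have st: "s \<otimes> inv t = inv a0 \<otimes> w \<otimes> a0'" using c w by (simp add: m_assoc inv_cancel_left)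
      have finY: "finite (Y (s \<otimes> inv t))" unfolding st Y_def
        using finite_Int_conjugate_double_coset[OF A A' w _ a0(2)] fin a0(1) A
        by (simp add: Y_def subgroup.m_inv_closed)
      \<comment> \<open>This is \<open>a s \<mapsto> a0\<inverse> a\<close>, so it compares the given point with the reference point \<open>a0 s\<close>.\<close>
      let ?\<phi> = "\<lambda>p. inv a0 \<otimes> p \<otimes> inv s"
      have "?\<phi> p \<in> Y (s \<otimes> inv t)" if p: "p \<in> Q w s t" for p
      proof -
        obtain a a' where a: "a \<in> A" "a' \<in> A'" "p = a \<otimes> s" "p = w \<otimes> a' \<otimes> t"
          using p unfolding Q_def by blast
        have ac: "a \<in> carrier G" "a' \<in> carrier G" using a Ac A'c by auto
        have "?\<phi> p = inv a0 \<otimes> a" unfolding a(3) using ac c by (simp add: m_assoc)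
        moreover have "inv a0 \<otimes> a \<in> A" using A a a0 by (simp add: subgroup.m_closed subgroup.m_inv_closed)
        moreover have "?\<phi> p = (s \<otimes> inv t) \<otimes> (inv a0' \<otimes> a') \<otimes> inv (s \<otimes> inv t)"
        proof -
          have "inv (s \<otimes> inv t) = t \<otimes> inv s" using c by (simp add: inv_mult_group)
          then show ?thesis
            unfolding st a(4) using ac c w by (simp add: m_assoc inv_cancel_left)
        qed
        moreover have "inv a0' \<otimes> a' \<in> A'" using A' a a0 by (simp add: subgroup.m_closed subgroup.m_inv_closed)
        ultimately show ?thesis using c unfolding Y_def mem_conjugate Int_iff
          by (metis inv_closed inv_inv m_closed)
      qed
      moreover have "inj_on ?\<phi> (Q w s t)"
      proof -
        have "p \<in> carrier G" if "p \<in> Q w s t" for p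
          using that Ac c by (auto simp: Q_def)
        then show ?thesis using c by (auto simp: inj_on_def)
      qed
      ultimately show ?thesis using finY by (meson card_inj_on_le image_subsetI inj_on_finite)
    qed simp
    have finU: "finite (\<Union>(s, t)\<in>?b \<times> ?b. Q w s t)" using Q finite_ball_at_one by auto
    have "card (nbhd A r \<inter> nbhd (w <# A') r) \<le> card (\<Union>(s, t)\<in>?b \<times> ?b. Q w s t)"
      using card_mono[OF finU cover] .
    also have "\<dots> \<le> (\<Sum>(s, t)\<in>?b \<times> ?b. card (Q w s t))"
      using card_UN_le[of "?b \<times> ?b" "\<lambda>(s, t). Q w s t"] finite_ball_at_one
      by (simp add: case_prod_unfold)
    also have "\<dots> \<le> N" unfolding N_def using Q by (intro sum_mono) auto
    finally show ?thesis using finite_subset[OF cover finU] by simp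
  qed
  then show ?thesis unfolding Y_def by blast
qed

text \<open>
  The five sides of the hexagon other than the one from \<open>1\<close> to \<open>a\<close>: two of them have lengths \<open>d \<one> u\<close> and
  \<open>d \<one> v\<close> and an end point in \<open>B\<close> and in \<open>a C\<close>, and the other three join points of one coset of a
  quasi-convex subgroup.
\<close>

lemma near_hexagon_sides:
  assumes \<delta>: "slim \<delta>"
    and B: "\<And>h k. h \<in> B \<Longrightarrow> k \<in> B \<Longrightarrow> interval h k \<subseteq> nbhd B \<kappa>" "subgroup B G"
    and C: "\<And>h k. h \<in> C \<Longrightarrow> k \<in> C \<Longrightarrow> interval h k \<subseteq> nbhd C \<kappa>" "subgroup C G"
    and A': "\<And>h k. h \<in> A' \<Longrightarrow> k \<in> A' \<Longrightarrow> interval h k \<subseteq> nbhd A' \<kappa>" "subgroup A' G"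
    and u: "u \<in> carrier G" and v: "v \<in> carrier G"
    and b: "b \<in> B" and c: "c \<in> C" and a': "a' \<in> A'" and a: "a = b \<otimes> u \<otimes> a' \<otimes> v \<otimes> c"
    and D: "D = 5 * \<delta> + (\<kappa> + d \<one> u + d \<one> v)"
    and p: "p \<in> interval \<one> a"
  shows "p \<in> nbhd B D \<union> nbhd ((b \<otimes> u) <# A') D \<union> nbhd (a <# C) D"
proof -
  let ?E = "\<kappa> + d \<one> u + d \<one> v"
  note Bc = subgroup.mem_carrier[OF B(2)] and Cc = subgroup.mem_carrier[OF C(2)]
    and A'c = subgroup.mem_carrier[OF A'(2)]
  define w where "w = b \<otimes> u"
  define z where "z = w \<otimes> a' \<otimes> v"
  have cc: "b \<in> carrier G" "c \<in> carrier G" "a' \<in> carrier G" using b c a' Bc Cc A'c by auto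
  have wc: "w \<in> carrier G" and zc: "z \<in> carrier G" using cc u v by (auto simp: w_def z_def)
  have az: "a = z \<otimes> c" by (simp add: a z_def w_def)
  have ac: "a \<in> carrier G" using az zc cc by simp
  have za: "z = a \<otimes> inv c" using az zc cc by (simp add: m_assoc)
  have pc: "p \<in> carrier G" using p by (simp add: interval_def)
  have "p \<in> interval \<one> (last [b, w, w \<otimes> a', z, a])" using p by simp
  from slim_polygon[OF \<delta> _ _ _ this] obtain y y' q where
    yy': "(y, y') \<in> set (zip (\<one> # [b, w, w \<otimes> a', z, a]) [b, w, w \<otimes> a', z, a])"
    and q: "q \<in> interval y y'" and pq: "d p q \<le> \<delta> * length [b, w, w \<otimes> a', z, a]"
    using cc wc zc ac by auto
  have pq: "d p q \<le> 5 * \<delta>" using pq by simp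
  have qc: "q \<in> carrier G" using q by (simp add: interval_def)
  have sub: "B \<subseteq> carrier G" "w <# A' \<subseteq> carrier G" "a <# C \<subseteq> carrier G"
    using Bc Cc A'c wc ac by (auto simp: l_coset_def)
  have "q \<in> nbhd B ?E \<or> q \<in> nbhd (w <# A') ?E \<or> q \<in> nbhd (a <# C) ?E"
  proof -
    consider "y = \<one>" "y' = b" | "y = b" "y' = w" | "y = w" "y' = w \<otimes> a'"
      | "y = w \<otimes> a'" "y' = z" | "y = z" "y' = a"
      using yy' by auto
    then show ?thesis
    proof cases
      case 1
      then have "q \<in> nbhd B \<kappa>" using B(1)[OF subgroup.one_closed[OF B(2)] b] q by auto
      then show ?thesis using nbhd_mono[of \<kappa> ?E B] by auto
    next
      case 2
      have "d b w = d \<one> u" using word_dist_eq_length[of b w] cc u by (simp add: w_def inv_cancel_left)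
      moreover have "d b q \<le> d b w" using q 2 by (simp add: interval_def)
      ultimately have "d q b \<le> ?E" using word_dist_sym[OF qc cc(1)] by simp
      then show ?thesis using b qc by (auto simp: nbhd_def)
    next
      case 3
      have "inv w \<otimes> q \<in> interval (inv w \<otimes> w) (inv w \<otimes> (w \<otimes> a'))"
        using interval_translate[of "inv w" w "w \<otimes> a'" q] q 3 wc cc by simp
      then have "inv w \<otimes> q \<in> nbhd A' \<kappa>"
        using A'(1)[OF subgroup.one_closed[OF A'(2)] a'] wc cc by (auto simp: inv_cancel_left)
      then have "q \<in> nbhd (w <# A') \<kappa>"
        using nbhd_translate[of A' w "inv w \<otimes> q" \<kappa>] subgroup.subset[OF A'(2)] wc qc
        by (simp add: inv_cancel_left)
      then show ?thesis using nbhd_mono[of \<kappa> ?E "w <# A'"] by auto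
    next
      case 4
      have "d (w \<otimes> a') z = d \<one> v"
        using word_dist_eq_length[of "w \<otimes> a'" z] cc v wc
        by (simp add: z_def inv_mult_group m_assoc inv_cancel_left)
      moreover have "d q z \<le> d (w \<otimes> a') z" using q 4 by (simp add: interval_def)
      ultimately have "d q z \<le> ?E" by simp
      moreover have "z \<in> a <# C" using za c C(2) by (auto simp: l_coset_def subgroup.m_inv_closed)
      ultimately show ?thesis using qc by (auto simp: nbhd_def)
    next
      case 5
      have "inv a \<otimes> q \<in> interval (inv a \<otimes> z) (inv a \<otimes> a)"
        using interval_translate[of "inv a" z a q] q 5 ac zc by simp
      then have "inv a \<otimes> q \<in> interval (inv c) \<one>" using za ac cc by (simp add: inv_cancel_left)
      then have "inv a \<otimes> q \<in> nbhd C \<kappa>"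
        using C(1)[OF subgroup.m_inv_closed[OF C(2) c] subgroup.one_closed[OF C(2)]] by auto
      then have "q \<in> nbhd (a <# C) \<kappa>"
        using nbhd_translate[of C a "inv a \<otimes> q" \<kappa>] subgroup.subset[OF C(2)] ac qc
        by (simp add: inv_cancel_left)
      then show ?thesis using nbhd_mono[of \<kappa> ?E "a <# C"] by auto
    qed
  qed
  then show ?thesis using nbhd_nbhd[OF _ pc _ pq] sub unfolding D w_def by blast
qed

text \<open>
  For a shortest \<open>s\<close> in the double coset, a point of the geodesic from \<open>1\<close> to \<open>s\<close> that
  is near \<open>l \<in> A \<inter> B\<close> cannot be far from \<open>1\<close>, since otherwise \<open>l\<inverse> s\<close> would be shorter than \<open>s\<close>;
  similarly at the other end with \<open>A \<inter> C\<close>. The points between these two end pieces lie in the bounded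
  overlap of \<open>A\<close> with a translate of \<open>A'\<close>, and there is one of them at each distance from \<open>1\<close>.
\<close>

lemma short_double_coset_representatives:
  assumes \<delta>: "slim \<delta>"
    and A: "quasiconvex A" and A': "quasiconvex A'" and B: "quasiconvex B" and C: "quasiconvex C"
    and u: "u \<in> carrier G" and v: "v \<in> carrier G"
  shows "\<exists>L. \<forall>a\<in>A. \<forall>b\<in>B. \<forall>c\<in>C. \<forall>a'\<in>A'. a = b \<otimes> u \<otimes> a' \<otimes> v \<otimes> c \<longrightarrow>
    finite (A \<inter> conjugate G A' (inv (b \<otimes> u))) \<longrightarrow>
    dcoset G (A \<inter> B) a (A \<inter> C) \<inter> ball_at_one L \<noteq> {}"
proof -
  have sA: "subgroup A G" and sA': "subgroup A' G" and sB: "subgroup B G" and sC: "subgroup C G"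
    using A A' B C by (simp_all add: quasiconvex_subgroup)
  note Ac = subgroup.mem_carrier[OF sA] and A'c = subgroup.mem_carrier[OF sA']
    and Bc = subgroup.mem_carrier[OF sB] and Cc = subgroup.mem_carrier[OF sC]
  obtain \<kappa> where \<kappa>: "\<And>X h k. X \<in> {A, A', B, C} \<Longrightarrow> h \<in> X \<Longrightarrow> k \<in> X \<Longrightarrow> interval h k \<subseteq> nbhd X \<kappa>"
    using quasiconvex_uniform[of "{A, A', B, C}"] A A' B C by blast
  define D where "D = 5 * \<delta> + (\<kappa> + d \<one> u + d \<one> v)"
  obtain R1 where R1: "nbhd A D \<inter> nbhd B D \<subseteq> nbhd (A \<inter> B) R1" using nbhd_Int_subgroup[OF sA sB] by blast
  obtain R2 where R2: "nbhd A D \<inter> nbhd C D \<subseteq> nbhd (A \<inter> C) R2" using nbhd_Int_subgroup[OF sA sC] by blast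
  obtain N where N: "\<And>w. w \<in> carrier G \<Longrightarrow> finite (A \<inter> conjugate G A' (inv w)) \<Longrightarrow>
      finite (nbhd A D \<inter> nbhd (w <# A') D) \<and> card (nbhd A D \<inter> nbhd (w <# A') D) \<le> N"
    using bounded_overlap_of_translates[OF sA sA', of D] by blast
  have "dcoset G (A \<inter> B) a (A \<inter> C) \<inter> ball_at_one (R1 + R2 + N + 1) \<noteq> {}"
    if a: "a \<in> A" and b: "b \<in> B" and c: "c \<in> C" and a': "a' \<in> A'"
      and eq: "a = b \<otimes> u \<otimes> a' \<otimes> v \<otimes> c" and fin: "finite (A \<inter> conjugate G A' (inv (b \<otimes> u)))"
    for a b c a'
  proof -
    let ?X = "dcoset G (A \<inter> B) a (A \<inter> C)"
    have sAB: "subgroup (A \<inter> B) G" and sAC: "subgroup (A \<inter> C) G"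
      using subgroups_Inter_pair sA sB sC by auto
    have "\<one> \<otimes> a \<otimes> \<one> \<in> ?X"
      using subgroup.one_closed[OF sAB] subgroup.one_closed[OF sAC] unfolding mem_dcoset by blast
    then obtain s where s: "s \<in> ?X" and short: "\<And>y. y \<in> ?X \<Longrightarrow> d \<one> s \<le> d \<one> y"
      using ex_has_least_nat[of "\<lambda>y. y \<in> ?X" _ "d \<one>"] by blast
    obtain x y where x: "x \<in> A \<inter> B" and y: "y \<in> A \<inter> C" and sxy: "s = x \<otimes> a \<otimes> y"
      using s by (auto simp: mem_dcoset)
    have cc: "a \<in> carrier G" "b \<in> carrier G" "c \<in> carrier G" "a' \<in> carrier G" "x \<in> carrier G" "y \<in> carrier G"
      using a b c a' x y Ac Bc Cc A'c by auto
    have sA_mem: "s \<in> A" using sxy x y a sA by (auto simp: subgroup.m_closed)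
    then have sc: "s \<in> carrier G" using Ac by auto
    have X: "?X = dcoset G (A \<inter> B) s (A \<inter> C)"
      using dcoset_absorb[OF sAB sAC cc(1) x y] sxy by simp
    \<comment> \<open>Replacing \<open>a\<close> by \<open>s = x a y\<close> replaces \<open>b\<close> by \<open>x b\<close> and \<open>c\<close> by \<open>c y\<close>, so the hypotheses carry over to \<open>s\<close>.\<close>
    define w where "w = x \<otimes> b \<otimes> u"
    have wc: "w \<in> carrier G" using cc u by (simp add: w_def)
    have xb: "x \<otimes> b \<in> B" and cy: "c \<otimes> y \<in> C" using x y b c sB sC by (auto simp: subgroup.m_closed)
    have s_eq: "s = x \<otimes> b \<otimes> u \<otimes> a' \<otimes> v \<otimes> (c \<otimes> y)"
      using cc u v by (simp add: sxy eq m_assoc)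
    have "finite (A \<inter> conjugate G A' (inv (x \<otimes> (b \<otimes> u) \<otimes> \<one>)))"
      using finite_Int_conjugate_double_coset[OF sA sA' _ _ subgroup.one_closed[OF sA'] fin, of x] x cc u
      by simp
    then have finw: "finite (A \<inter> conjugate G A' (inv w))" using cc u by (simp add: w_def m_assoc)
    let ?P = "nbhd A D \<inter> nbhd (w <# A') D"
    have trichotomy: "d \<one> p \<le> R1 \<or> d p s \<le> R2 \<or> p \<in> ?P" if p: "p \<in> interval \<one> s" for p
    proof -
      have pc: "p \<in> carrier G" and len: "d \<one> p + d p s = d \<one> s" using p by (auto simp: interval_def)
      have pA: "p \<in> nbhd A D"
        using \<kappa>[of A \<one> s] subgroup.one_closed[OF sA] sA_mem p nbhd_mono[of \<kappa> D A] by (auto simp: D_def)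
      consider "p \<in> nbhd B D" | "p \<in> nbhd (w <# A') D" | "p \<in> nbhd (s <# C) D"
        using near_hexagon_sides[OF \<delta> \<kappa> sB \<kappa> sC \<kappa> sA' u v xb cy a' s_eq D_def p] by (auto simp: w_def)
      then show ?thesis
      proof cases
        case 1
        then obtain l where l: "l \<in> A \<inter> B" "d p l \<le> R1" using R1 pA by (auto simp: nbhd_def)
        have lc: "l \<in> carrier G" using l Ac by auto
        have "inv l \<otimes> s \<otimes> \<one> \<in> ?X" unfolding X mem_dcoset
          using subgroup.m_inv_closed[OF sAB l(1)] subgroup.one_closed[OF sAC] by blast
        then have "d \<one> s \<le> d l s" using short word_dist_eq_length[OF lc sc] lc sc by simp
        also have "\<dots> \<le> d l p + d p s" by (rule word_dist_triangle[OF lc pc sc])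
        finally have "d \<one> p \<le> R1" using len l(2) word_dist_sym[OF lc pc] by simp
        then show ?thesis ..
      next
        case 3
        have sC': "s <# C \<subseteq> carrier G" using sc Cc by (auto simp: l_coset_def)
        have "inv s <# (s <# C) = C" "inv s <# A = A"
          using sc sC sA sA_mem by (simp_all add: lcos_m_assoc lcos_mult_one subgroup.subset coset_join3 subgroup.m_inv_closed)
        then have "inv s \<otimes> p \<in> nbhd C D \<inter> nbhd A D"
          using nbhd_translate[OF sC' inv_closed[OF sc] 3]
            nbhd_translate[OF subgroup.subset[OF sA] inv_closed[OF sc] pA] by simp
        then obtain l where l: "l \<in> A \<inter> C" "d (inv s \<otimes> p) l \<le> R2" using R2 by (auto simp: nbhd_def)
        have lc: "l \<in> carrier G" using l Ac by auto
        have "\<one> \<otimes> s \<otimes> l \<in> ?X" unfolding X mem_dcoset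
          using l(1) subgroup.one_closed[OF sAB] by blast
        then have "d \<one> s \<le> d \<one> (s \<otimes> l)" using short sc by simp
        also have "\<dots> \<le> d \<one> p + d p (s \<otimes> l)" using pc sc lc by (intro word_dist_triangle) auto
        also have "d p (s \<otimes> l) = d (inv s \<otimes> p) l"
          using word_dist_translate[OF sc _ lc, of "inv s \<otimes> p"] sc pc by (simp add: inv_cancel_left)
        finally have "d p s \<le> R2" using l(2) len by simp
        then show ?thesis by simp
      qed (use pA in blast)
    qed
    let ?n = "d \<one> s"
    have "\<exists>q. \<forall>k\<le>?n. q k \<in> interval \<one> s \<and> d \<one> (q k) = k \<and> d (q k) s = ?n - k"
      using interval_point_at[OF one_closed sc] by (intro choice) blast
    then obtain q where q: "\<And>k. k \<le> ?n \<Longrightarrow> q k \<in> interval \<one> s \<and> d \<one> (q k) = k \<and> d (q k) s = ?n - k"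
      by blast
    have "inj_on q {R1<..<?n - R2}" using q by (intro inj_on_inverseI[where g = "d \<one>"]) auto
    moreover have "q ` {R1<..<?n - R2} \<subseteq> ?P"
    proof (intro image_subsetI)
      fix k assume k: "k \<in> {R1<..<?n - R2}"
      then have "k \<le> ?n" by auto
      from trichotomy[of "q k"] q[OF this] k show "q k \<in> ?P" by auto
    qed
    ultimately have "card {R1<..<?n - R2} \<le> card ?P" using N[OF wc finw] by (intro card_inj_on_le) auto
    also have "\<dots> \<le> N" using N[OF wc finw] by blast
    finally have "?n \<le> R1 + R2 + N + 1" by simp
    then show ?thesis using s sc by (auto simp: ball_at_one_def)
  qed
  then show ?thesis by blast
qed

end

section \<open>The finite intersection properties\<close>

lemma dcoset_carrier_update: "dcoset (G\<lparr>carrier := X\<rparr>) H g K = dcoset G H g K"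
  by (simp add: dcoset_def r_coset_def set_mult_def)

context group
begin

lemma group_hom_conjugation:
  assumes "g \<in> carrier G"
  shows "group_hom G G (\<lambda>x. inv g \<otimes> x \<otimes> g)"
  using assms by unfold_locales (auto simp: hom_def m_assoc inv_cancel_left)

lemma conjugate_eq_image: "conjugate G H g = (\<lambda>x. inv g \<otimes> x \<otimes> g) ` H"
  by (auto simp: mem_conjugate)

lemma subgroup_conjugate:
  assumes "subgroup H G" "g \<in> carrier G"
  shows "subgroup (conjugate G H g) G"
  unfolding conjugate_eq_image
  using group_hom.subgroup_img_is_subgroup[OF group_hom_conjugation[OF assms(2)] assms(1)] .

lemma fg_subgroup_conjugate:
  assumes H: "fg_subgroup G H" and g: "g \<in> carrier G"
  shows "fg_subgroup G (conjugate G H g)"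
proof -
  obtain T where sH: "subgroup H G" and T: "finite T" "T \<subseteq> carrier G" "generate G T = H"
    using H unfolding fg_subgroup_def by blast
  let ?\<phi> = "\<lambda>x. inv g \<otimes> x \<otimes> g"
  have "generate G (?\<phi> ` T) = conjugate G H g"
    unfolding conjugate_eq_image
    using group_hom.generate_img[OF group_hom_conjugation[OF g] T(2)] T(3) by simp
  moreover have "finite (?\<phi> ` T)" "?\<phi> ` T \<subseteq> carrier G" using T g by auto
  ultimately show ?thesis using subgroup_conjugate[OF sH g] unfolding fg_subgroup_def by blast
qed

lemma dcoset_self:
  assumes "subgroup H G" "subgroup K G" "x \<in> carrier G"
  shows "x \<in> dcoset G H x K"
proof -
  have "x = \<one> \<otimes> x \<otimes> \<one>" using assms by simp
  then show ?thesis using assms by (auto simp: mem_dcoset subgroup.one_closed intro!: bexI[of _ \<one>])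
qed

text \<open>
  Put \<open>y = f\<inverse> b f' \<in> A\<close> and \<open>z = g'\<inverse> c g\<close>. The equation becomes \<open>a = y a' z\<close>, so
  \<open>z\<close> is in \<open>A\<close> too. Now \<open>f' = b\<inverse> f y\<close> and \<open>g = c\<inverse> g' z\<close> give the first two claims, and if \<open>f = f'\<close> and
  \<open>g = g'\<close>, then \<open>y\<close> and \<open>z\<close> are conjugates of \<open>b\<close> and \<open>c\<close>, which gives the third.
\<close>

lemma colliding_double_cosets:
  assumes A: "subgroup A G" and B: "subgroup B G" and C: "subgroup C G"
    and carr: "f \<in> carrier G" "f' \<in> carrier G" "g \<in> carrier G" "g' \<in> carrier G"
    and mem: "a \<in> A" "a' \<in> A" "b \<in> B" "c \<in> C"
    and eq: "f \<otimes> a \<otimes> inv g = b \<otimes> (f' \<otimes> a' \<otimes> inv g') \<otimes> c"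
    and y: "inv f \<otimes> b \<otimes> f' \<in> A"
  shows "dcoset G B f' A = dcoset G B f A" "dcoset G C g' A = dcoset G C g A"
    "f = f' \<Longrightarrow> g = g' \<Longrightarrow>
      dcoset G (A \<inter> conjugate G B f) a (A \<inter> conjugate G C g) =
      dcoset G (A \<inter> conjugate G B f) a' (A \<inter> conjugate G C g)"
proof -
  let ?y = "inv f \<otimes> b \<otimes> f'" and ?z = "inv g' \<otimes> c \<otimes> g"
  have mc: "a \<in> carrier G" "a' \<in> carrier G" "b \<in> carrier G" "c \<in> carrier G"
    using mem A[THEN subgroup.mem_carrier] B[THEN subgroup.mem_carrier] C[THEN subgroup.mem_carrier]
    by simp_all
  have "f' = inv b \<otimes> f \<otimes> ?y" using mc carr by (simp add: m_assoc inv_cancel_left)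
  then show "dcoset G B f' A = dcoset G B f A"
    using dcoset_absorb[OF B A carr(1) subgroup.m_inv_closed[OF B mem(3)] y] by simp
  have "inv f \<otimes> (f \<otimes> a \<otimes> inv g) \<otimes> g = inv f \<otimes> (b \<otimes> (f' \<otimes> a' \<otimes> inv g') \<otimes> c) \<otimes> g"
    by (simp add: eq)
  then have a_eq: "a = ?y \<otimes> a' \<otimes> ?z" using mc carr by (simp add: m_assoc inv_cancel_left)
  have "?z = inv a' \<otimes> (inv ?y \<otimes> a)" using mc carr unfolding a_eq
    by (simp add: m_assoc inv_mult_group inv_cancel_left)
  then have z: "?z \<in> A" using A mem y by (simp add: subgroup.m_closed subgroup.m_inv_closed)
  have "g = inv c \<otimes> g' \<otimes> ?z" using mc carr by (simp add: m_assoc inv_cancel_left)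
  then show "dcoset G C g' A = dcoset G C g A"
    using dcoset_absorb[OF C A carr(4) subgroup.m_inv_closed[OF C mem(4)] z] by simp
  assume fg: "f = f'" "g = g'"
  have sub: "subgroup (A \<inter> conjugate G B f) G" "subgroup (A \<inter> conjugate G C g) G"
    using subgroups_Inter_pair A subgroup_conjugate B C carr by auto
  have "?y \<in> A \<inter> conjugate G B f" using y mem fg by (auto simp: mem_conjugate)
  moreover have "?z \<in> A \<inter> conjugate G C g" using z mem fg by (auto simp: mem_conjugate)
  ultimately show "dcoset G (A \<inter> conjugate G B f) a (A \<inter> conjugate G C g) =
      dcoset G (A \<inter> conjugate G B f) a' (A \<inter> conjugate G C g)"
    using dcoset_absorb[OF sub mc(2)] a_eq by metis
qed

end

locale lqc_hyperbolic_group = word_metric_group +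
  assumes hyperbolic: "hyperbolic_wrt G S"
    and fg_quasiconvex: "fg_subgroup G H \<Longrightarrow> quasiconvex_wrt G S H"
begin

lemma fg_imp_quasiconvex: "fg_subgroup G H \<Longrightarrow> quasiconvex H"
  by (rule quasiconvexI[OF _ fg_quasiconvex]) (simp_all add: fg_subgroup_def)

lemma fg_imp_subgroup: "fg_subgroup G H \<Longrightarrow> subgroup H G"
  by (simp add: fg_subgroup_def)

text \<open>
  This is \<open>short_double_coset_representatives\<close> with the metric removed. The same element also represents
  the larger double coset \<open>B a C\<close>, and these are what the relative f.g.i.p. counts.
\<close>

lemma finite_double_coset_representatives:
  assumes fg: "fg_subgroup G A" "fg_subgroup G A'" "fg_subgroup G B" "fg_subgroup G C"
    and uv: "u \<in> carrier G" "v \<in> carrier G"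
  obtains F where "finite F" "F \<subseteq> carrier G"
    "\<And>a b c a'. a \<in> A \<Longrightarrow> b \<in> B \<Longrightarrow> c \<in> C \<Longrightarrow> a' \<in> A' \<Longrightarrow> a = b \<otimes> u \<otimes> a' \<otimes> v \<otimes> c \<Longrightarrow>
      finite (A \<inter> conjugate G A' (inv (b \<otimes> u))) \<Longrightarrow>
      \<exists>x\<in>F. dcoset G (A \<inter> B) a (A \<inter> C) = dcoset G (A \<inter> B) x (A \<inter> C) \<and>
        dcoset G B a C = dcoset G B x C"
proof -
  obtain \<delta> where \<delta>: "slim \<delta>" using hyperbolic_imp_slim[OF hyperbolic] by blast
  obtain L where L: "\<And>a b c a'. a \<in> A \<Longrightarrow> b \<in> B \<Longrightarrow> c \<in> C \<Longrightarrow> a' \<in> A' \<Longrightarrow> a = b \<otimes> u \<otimes> a' \<otimes> v \<otimes> c \<Longrightarrow>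
      finite (A \<inter> conjugate G A' (inv (b \<otimes> u))) \<Longrightarrow>
      dcoset G (A \<inter> B) a (A \<inter> C) \<inter> ball_at_one L \<noteq> {}"
    using short_double_coset_representatives[OF \<delta> fg[THEN fg_imp_quasiconvex] uv] by blast
  note sub = fg[THEN fg_imp_subgroup]
  show ?thesis
  proof (rule that[of "ball_at_one L"])
    fix a b c a'
    assume as: "a \<in> A" "b \<in> B" "c \<in> C" "a' \<in> A'" "a = b \<otimes> u \<otimes> a' \<otimes> v \<otimes> c"
      "finite (A \<inter> conjugate G A' (inv (b \<otimes> u)))"
    have ac: "a \<in> carrier G" using subgroup.mem_carrier[OF sub(1) as(1)] .
    obtain x where x: "x \<in> ball_at_one L" "x \<in> dcoset G (A \<inter> B) a (A \<inter> C)" using L[OF as] by blast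
    then obtain h k where hk: "h \<in> A \<inter> B" "k \<in> A \<inter> C" "x = h \<otimes> a \<otimes> k" by (auto simp: mem_dcoset)
    have "dcoset G (A \<inter> B) x (A \<inter> C) = dcoset G (A \<inter> B) a (A \<inter> C)" unfolding hk(3)
      using dcoset_absorb[OF subgroups_Inter_pair[OF sub(1,3)] subgroups_Inter_pair[OF sub(1,4)] ac hk(1,2)] .
    moreover have "dcoset G B x C = dcoset G B a C" unfolding hk(3)
      using dcoset_absorb[OF sub(3,4) ac] hk by blast
    ultimately show "\<exists>x\<in>ball_at_one L. dcoset G (A \<inter> B) a (A \<inter> C) = dcoset G (A \<inter> B) x (A \<inter> C) \<and>
        dcoset G B a C = dcoset G B x C"
      using x(1) by auto
  qed (use finite_ball_at_one in \<open>auto simp: ball_at_one_def\<close>)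
qed

lemma fgip: "fgip G"
  unfolding fgip_def using quasiconvex_imp_fg quasiconvex_Int fg_imp_quasiconvex by blast

text \<open>
  If \<open>g\<inverse> h g \<in> K\<close> is not in \<open>A\<close>, then \<open>g = h\<inverse> g (g\<inverse> h g)\<close> is a factorization to which
  \<open>finite_double_coset_representatives\<close> applies with \<open>A' = A\<close> and \<open>u = v = 1\<close>; the finiteness hypothesis holds since \<open>h \<notin> A\<close>.
\<close>

lemma relative_fgip_of_almost_malnormal:
  assumes A: "fg_subgroup G A"
    and mal: "\<And>g. g \<in> carrier G \<Longrightarrow> finite (A \<inter> conjugate G A g) \<or> g \<in> A"
  shows "relative_fgip G A"
proof -
  have "finite {dcoset G H g K | g. g \<in> A \<and> \<not> conjugate G H g \<inter> K \<subseteq> A}"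
    if HK: "fg_subgroup G H" "fg_subgroup G K" for H K
  proof -
    note sub = A[THEN fg_imp_subgroup] HK[THEN fg_imp_subgroup]
    obtain F where F: "finite F" and rep: "\<And>a b c a'. a \<in> A \<Longrightarrow> b \<in> H \<Longrightarrow> c \<in> K \<Longrightarrow> a' \<in> A \<Longrightarrow>
        a = b \<otimes> \<one> \<otimes> a' \<otimes> \<one> \<otimes> c \<Longrightarrow> finite (A \<inter> conjugate G A (inv (b \<otimes> \<one>))) \<Longrightarrow>
        \<exists>x\<in>F. dcoset G H a K = dcoset G H x K"
      using finite_double_coset_representatives[OF A A HK one_closed one_closed] by metis
    have "dcoset G H g K \<in> (\<lambda>x. dcoset G H x K) ` F"
      if g: "g \<in> A" and n: "\<not> conjugate G H g \<inter> K \<subseteq> A" for g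
    proof -
      obtain h where h: "h \<in> H" "inv g \<otimes> h \<otimes> g \<in> K" "inv g \<otimes> h \<otimes> g \<notin> A"
        using n unfolding subset_iff Int_iff mem_conjugate by metis
      have c: "g \<in> carrier G" "h \<in> carrier G" 
        using subgroup.mem_carrier[OF sub(1) g] subgroup.mem_carrier[OF sub(2) h(1)] .
      have "h \<notin> A" using h(3) g sub(1) by (auto simp: subgroup.m_closed subgroup.m_inv_closed)
      then have "finite (A \<inter> conjugate G A (inv (inv h \<otimes> \<one>)))" using mal[of h] c by simp
      moreover have "g = inv h \<otimes> \<one> \<otimes> g \<otimes> \<one> \<otimes> (inv g \<otimes> h \<otimes> g)"
        using c by (simp add: m_assoc inv_cancel_left)
      ultimately show ?thesis
        using rep[OF g subgroup.m_inv_closed[OF sub(2) h(1)] h(2) g] by blast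
    qed
    then have "{dcoset G H g K | g. g \<in> A \<and> \<not> conjugate G H g \<inter> K \<subseteq> A} \<subseteq> (\<lambda>x. dcoset G H x K) ` F"
      by blast
    then show ?thesis using F finite_surj by blast
  qed
  then show ?thesis unfolding relative_fgip_def using fgip by blast
qed

text \<open>
  The double cosets in the domain of \<open>q\<^bsub>f,g\<^esub>\<close> for \<open>A\<close> that have the same image in the set of \<open>(B, C)\<close>-double cosets as one in the
  domain of \<open>q\<^bsub>f',g'\<^esub>\<close> for \<open>A'\<close>, provided that this is witnessed by some \<open>b\<close> for which the cosets \<open>f A\<close> and \<open>b f' A'\<close>
  have bounded overlap. In an almost malnormal collection the remaining collisions are those of \<open>colliding_double_cosets\<close>.
\<close>

definition distant_collisions ::
    "'a set \<Rightarrow> 'a set \<Rightarrow> 'a set \<Rightarrow> 'a set \<Rightarrow> 'a \<Rightarrow> 'a \<Rightarrow> 'a \<Rightarrow> 'a \<Rightarrow> 'a set set" where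
  "distant_collisions A A' B C f g f' g' =
    {dcoset G (A \<inter> conjugate G B f) a (A \<inter> conjugate G C g) | a. a \<in> A \<and>
       (\<exists>b\<in>B. \<exists>c\<in>C. \<exists>a'\<in>A'. f \<otimes> a \<otimes> inv g = b \<otimes> (f' \<otimes> a' \<otimes> inv g') \<otimes> c \<and>
          finite (A \<inter> conjugate G A' (inv (inv f \<otimes> b \<otimes> f'))))}"

text \<open>
  Multiplying the collision equation by \<open>f\<inverse>\<close> on the left and by \<open>g\<close> on the right turns it into
  \<open>a = b\<^sup>f u a' v c\<^sup>g\<close> with the fixed elements \<open>u = f\<inverse> f'\<close> and \<open>v = g'\<inverse> g\<close>, to which
  \<open>finite_double_coset_representatives\<close> applies with the conjugates of \<open>B\<close> and \<open>C\<close>.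
\<close>

lemma finite_distant_collisions:
  assumes fg: "fg_subgroup G A" "fg_subgroup G A'" "fg_subgroup G B" "fg_subgroup G C"
    and carr: "f \<in> carrier G" "g \<in> carrier G" "f' \<in> carrier G" "g' \<in> carrier G"
  shows "finite (distant_collisions A A' B C f g f' g')"
proof -
  note sub = fg[THEN fg_imp_subgroup]
  let ?B = "conjugate G B f" and ?C = "conjugate G C g"
  let ?u = "inv f \<otimes> f'" and ?v = "inv g' \<otimes> g"
  obtain F where F: "finite F" and rep: "\<And>a b c a'. a \<in> A \<Longrightarrow> b \<in> ?B \<Longrightarrow> c \<in> ?C \<Longrightarrow> a' \<in> A' \<Longrightarrow>
      a = b \<otimes> ?u \<otimes> a' \<otimes> ?v \<otimes> c \<Longrightarrow> finite (A \<inter> conjugate G A' (inv (b \<otimes> ?u))) \<Longrightarrow>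
      \<exists>x\<in>F. dcoset G (A \<inter> ?B) a (A \<inter> ?C) = dcoset G (A \<inter> ?B) x (A \<inter> ?C)"
    using finite_double_coset_representatives[OF fg(1,2) fg_subgroup_conjugate[OF fg(3) carr(1)]
        fg_subgroup_conjugate[OF fg(4) carr(2)]
        m_closed[OF inv_closed[OF carr(1)] carr(3)] m_closed[OF inv_closed[OF carr(4)] carr(2)]]
    by metis
  have "X \<in> (\<lambda>x. dcoset G (A \<inter> ?B) x (A \<inter> ?C)) ` F" if X: "X \<in> distant_collisions A A' B C f g f' g'" for X
  proof -
    obtain a b c a' where mem: "a \<in> A" "b \<in> B" "c \<in> C" "a' \<in> A'"
      and Xa: "X = dcoset G (A \<inter> ?B) a (A \<inter> ?C)"
      and eq: "f \<otimes> a \<otimes> inv g = b \<otimes> (f' \<otimes> a' \<otimes> inv g') \<otimes> c"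
      and fin: "finite (A \<inter> conjugate G A' (inv (inv f \<otimes> b \<otimes> f')))"
      using X unfolding distant_collisions_def by blast
    have mc: "a \<in> carrier G" "b \<in> carrier G" "c \<in> carrier G" "a' \<in> carrier G"
      using mem sub[THEN subgroup.mem_carrier] by simp_all
    have "inv f \<otimes> (f \<otimes> a \<otimes> inv g) \<otimes> g = inv f \<otimes> (b \<otimes> (f' \<otimes> a' \<otimes> inv g') \<otimes> c) \<otimes> g"
      by (simp add: eq)
    then have a_eq: "a = (inv f \<otimes> b \<otimes> f) \<otimes> ?u \<otimes> a' \<otimes> ?v \<otimes> (inv g \<otimes> c \<otimes> g)"
      using mc carr by (simp add: m_assoc inv_cancel_left)
    have w_eq: "inv f \<otimes> b \<otimes> f' = (inv f \<otimes> b \<otimes> f) \<otimes> ?u"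
      using mc carr by (simp add: m_assoc inv_cancel_left)
    have bc: "inv f \<otimes> b \<otimes> f \<in> ?B" "inv g \<otimes> c \<otimes> g \<in> ?C"
      using mem by (auto simp: mem_conjugate)
    obtain x where "x \<in> F" "dcoset G (A \<inter> ?B) a (A \<inter> ?C) = dcoset G (A \<inter> ?B) x (A \<inter> ?C)"
      using rep[OF mem(1) bc mem(4) a_eq fin[unfolded w_eq]] by blast
    then show ?thesis unfolding Xa by blast
  qed
  then show ?thesis using F by (meson finite_surj subsetI)
qed

text \<open>
  Below, \<open>W D\<close> is the disjoint union of all fibres over \<open>D\<close>, so the inner sum is its cardinality. Two
  distinct elements of \<open>W D\<close> both lie in the finite set \<open>T\<close>; hence \<open>W D\<close> is finite, and it has at most one
  element unless \<open>D\<close> is one of the finitely many images of elements of \<open>T\<close>.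
\<close>

lemma fcip_of_almost_malnormal:
  assumes I: "finite I" and A: "\<And>i. i \<in> I \<Longrightarrow> fg_subgroup G (A i)"
    and mal: "almost_malnormal_collection G I A"
  shows "fcip_relative G I A"
  unfolding fcip_relative_def
proof (intro allI impI, elim conjE)
  fix B C \<F> \<G>
  assume B: "fg_subgroup G B" and C: "fg_subgroup G C"
    and \<F>: "\<forall>i\<in>I. finite (\<F> i) \<and> \<F> i \<subseteq> carrier G \<and> inj_on (\<lambda>f. dcoset G B f (A i)) (\<F> i)"
    and \<G>: "\<forall>i\<in>I. finite (\<G> i) \<and> \<G> i \<subseteq> carrier G \<and> inj_on (\<lambda>g. dcoset G C g (A i)) (\<G> i)"
  note sB = fg_imp_subgroup[OF B] and sC = fg_imp_subgroup[OF C]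
  define J where "J = (SIGMA i:I. \<F> i \<times> \<G> i)"
  define fib where "fib j D = (case j of (i, f, g) \<Rightarrow> coset_map_fibre G (A i) B C f g D)" for j D
  define W where "W D = Sigma J (\<lambda>j. fib j D)" for D
  have finJ: "finite J" unfolding J_def using I \<F> \<G> by auto
  define T where "T = (\<Union>j\<in>J. \<Union>j'\<in>J. case j of (i, f, g) \<Rightarrow> case j' of (i', f', g') \<Rightarrow>
    {j} \<times> distant_collisions (A i) (A i') B C f g f' g')"
  have finT: "finite T"
  proof -
    have "finite (distant_collisions (A i) (A i') B C f g f' g')"
      if "(i, f, g) \<in> J" "(i', f', g') \<in> J" for i f g i' f' g'
      using that A B C \<F> \<G> by (intro finite_distant_collisions) (auto simp: J_def)
    then show ?thesis unfolding T_def using finJ by (auto split: prod.split)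
  qed
  have collision: "t \<in> T" if t: "t \<in> W D" and t': "t' \<in> W D" and ne: "t \<noteq> t'" for t t' D
  proof -
    obtain i f g X i' f' g' X' where tt: "t = ((i, f, g), X)" "t' = ((i', f', g'), X')"
      by (metis surj_pair)
    have J: "(i, f, g) \<in> J" "(i', f', g') \<in> J" using t t' tt by (auto simp: W_def)
    have i: "i \<in> I" "f \<in> \<F> i" "g \<in> \<G> i" and i': "i' \<in> I" "f' \<in> \<F> i'" "g' \<in> \<G> i'"
      using J by (auto simp: J_def)
    have carr: "f \<in> carrier G" "f' \<in> carrier G" "g \<in> carrier G" "g' \<in> carrier G"
      using i i' \<F> \<G> by auto
    have sA: "subgroup (A i) G" "subgroup (A i') G" using A i i' fg_imp_subgroup by auto
    have X: "X \<in> coset_map_fibre G (A i) B C f g D" "X' \<in> coset_map_fibre G (A i') B C f' g' D"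
      using t t' tt by (auto simp: W_def fib_def)
    obtain a where a: "a \<in> A i" "X = dcoset G (A i \<inter> conjugate G B f) a (A i \<inter> conjugate G C g)"
      and aD: "D = dcoset G B (f \<otimes> a \<otimes> inv g) C"
      using X(1) coset_map_dcoset[OF sA(1) sB sC carr(1,3)]
      by (auto simp: coset_map_fibre_def dcosets_def dcoset_carrier_update)
    obtain a' where a': "a' \<in> A i'" "X' = dcoset G (A i' \<inter> conjugate G B f') a' (A i' \<inter> conjugate G C g')"
      and a'D: "D = dcoset G B (f' \<otimes> a' \<otimes> inv g') C"
      using X(2) coset_map_dcoset[OF sA(2) sB sC carr(2,4)]
      by (auto simp: coset_map_fibre_def dcosets_def dcoset_carrier_update)
    have "a \<in> carrier G" using subgroup.mem_carrier[OF sA(1) a(1)] .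
    then have "f \<otimes> a \<otimes> inv g \<in> D" unfolding aD using dcoset_self[OF sB sC] carr by simp
    then obtain b c where bc: "b \<in> B" "c \<in> C"
      and eq: "f \<otimes> a \<otimes> inv g = b \<otimes> (f' \<otimes> a' \<otimes> inv g') \<otimes> c"
      unfolding a'D by (auto simp: mem_dcoset)
    have bcarr: "b \<in> carrier G" using subgroup.mem_carrier[OF sB bc(1)] .
    let ?y = "inv f \<otimes> b \<otimes> f'"
    have yc: "?y \<in> carrier G" using carr bcarr by simp
    have fin: "finite (A i \<inter> conjugate G (A i') (inv ?y))"
    proof (rule ccontr)
      assume "infinite (A i \<inter> conjugate G (A i') (inv ?y))"
      then have ii: "i' = i" and "inv ?y \<in> A i"
        using mal i(1) i'(1) yc unfolding almost_malnormal_collection_def by auto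
      then have y: "?y \<in> A i" using subgroup.m_inv_closed[OF sA(1)] yc by fastforce
      note col = colliding_double_cosets[OF sA(1) sB sC carr a(1) _ bc eq y]
      have a'i: "a' \<in> A i" using a'(1) ii by simp
      have "f = f'" using col(1)[OF a'i] \<F> i i' ii by (auto dest: inj_onD)
      moreover have "g = g'" using col(2)[OF a'i] \<G> i i' ii by (auto dest: inj_onD)
      ultimately show False using col(3)[OF a'i] ne tt ii a(2) a'(2) by auto
    qed
    have "X \<in> distant_collisions (A i) (A i') B C f g f' g'"
      unfolding distant_collisions_def using a a'(1) bc eq fin by blast
    then show ?thesis unfolding T_def using J tt(1) by fastforce
  qed
  have finW: "finite (W D)" for D
  proof (cases "\<exists>t. W D \<subseteq> {t}")
    case False
    have "W D \<subseteq> T"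
    proof
      fix t assume t: "t \<in> W D"
      then obtain t' where "t' \<in> W D" "t \<noteq> t'" using False by blast
      then show "t \<in> T" using collision t by blast
    qed
    then show ?thesis using finT finite_subset by blast
  qed (use finite_subset in blast)
  have finfib: "finite (fib j D)" if "j \<in> J" for j D
  proof -
    have "fib j D \<subseteq> snd ` W D" using that by (force simp: W_def)
    then show ?thesis using finW finite_surj by blast
  qed
  let ?inner = "\<lambda>D. \<Sum>\<^sub>\<infinity>i\<in>I. \<Sum>f\<in>\<F> i. \<Sum>g\<in>\<G> i. ecard (coset_map_fibre G (A i) B C f g D)"
  have inner: "?inner D = of_nat (card (W D))" for D
  proof -
    have "?inner D = (\<Sum>i\<in>I. \<Sum>(f, g)\<in>\<F> i \<times> \<G> i. ecard (coset_map_fibre G (A i) B C f g D))"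
      using I by (simp add: sum.cartesian_product)
    also have "\<dots> = (\<Sum>j\<in>J. ecard (fib j D))"
      unfolding J_def using I \<F> \<G> by (subst sum.Sigma) (auto simp: fib_def case_prod_unfold)
    also have "\<dots> = (\<Sum>j\<in>J. of_nat (card (fib j D)))"
      using finfib by (intro sum.cong refl) simp
    also have "\<dots> = of_nat (card (W D))" unfolding W_def using finJ finfib by simp
    finally show ?thesis .
  qed
  let ?term = "\<lambda>D. max 0 (?inner D - 1)"
  define bad where "bad = (\<lambda>((i, f, g), X). coset_map G B C f g X) ` T"
  have good: "?term D = 0" if "D \<notin> bad" for D
  proof -
    have "card (W D) \<le> 1"
    proof (rule ccontr)
      assume "\<not> card (W D) \<le> 1"
      then obtain t t' where t: "t \<in> W D" "t' \<in> W D" "t \<noteq> t'"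
        by (metis card_le_Suc0_iff_eq[OF finW] One_nat_def)
      then have "t \<in> T" by (rule collision)
      moreover have "D = (\<lambda>((i, f, g), X). coset_map G B C f g X) t"
        using t(1) by (auto simp: W_def fib_def coset_map_fibre_def)
      ultimately show False using that unfolding bad_def by blast
    qed
    then have "card (W D) = 0 \<or> card (W D) = 1" by linarith
    then show ?thesis unfolding inner by auto
  qed
  have fin_bad: "finite (dcosets G B C \<inter> bad)" unfolding bad_def using finT by simp
  have "(\<Sum>\<^sub>\<infinity>D\<in>dcosets G B C. ?term D) = (\<Sum>\<^sub>\<infinity>D\<in>dcosets G B C \<inter> bad. ?term D)"
    by (rule infsum_cong_neutral) (use good in auto)
  also have "\<dots> = (\<Sum>D\<in>dcosets G B C \<inter> bad. ?term D)" using fin_bad by (rule infsum_finite)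
  also have "\<dots> < \<infinity>"
  proof -
    have "?term D < \<infinity>" for D
    proof -
      have "?term D \<le> of_nat (card (W D))" unfolding inner by (simp add: diff_le_self_ennreal)
      also have "\<dots> < \<infinity>" by (simp add: of_nat_less_top)
      finally show ?thesis .
    qed
    then show ?thesis using fin_bad by (simp add: less_top)
  qed
  finally show "(\<Sum>\<^sub>\<infinity>D\<in>dcosets G B C. ?term D) < \<infinity>" .
qed

end

theorem theoremC:
  fixes G :: "('a, 'b) monoid_scheme"
    and I :: "'i set"
    and A :: "'i \<Rightarrow> 'a set"
  assumes "locally_quasiconvex_hyperbolic G"
    and "finite I"
    and "\<And>i. i \<in> I \<Longrightarrow> fg_subgroup G (A i)"
    and "almost_malnormal_collection G I A"
  shows "fcip_relative G I A \<and> (\<forall>i\<in>I. relative_fgip G (A i))"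
proof -
  obtain S where "group G" and S: "finite S" "S \<subseteq> carrier G" "generate G S = carrier G"
    "hyperbolic_wrt G S" "\<And>H. fg_subgroup G H \<Longrightarrow> quasiconvex_wrt G S H"
    using assms(1) unfolding locally_quasiconvex_hyperbolic_def by blast
  then interpret lqc_hyperbolic_group G S
    by (simp add: lqc_hyperbolic_group_def word_metric_group_def
        word_metric_group_axioms_def lqc_hyperbolic_group_axioms_def)
  have "relative_fgip G (A i)" if "i \<in> I" for i
    using that assms(3,4)
    by (intro relative_fgip_of_almost_malnormal) (auto simp: almost_malnormal_collection_def)
  then show ?thesis using fcip_of_almost_malnormal assms(2-4) by blast
qed

end
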